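(* In the setting below, let $p_0\in C^1(\mathbb R)$ with $p_0(\xi)=0$ for all $\xi\ge0$, and assume $p_0$ and $p_0'$ are bounded. Let $(p,u)$ be the solution of the Cauchy problem $$p_t+K(x)u_x=0,\qquad u_t+\rho(x)^{-1}p_x=0,\qquad x\in\mathbb R,\ t>0,$$ with initial data $p(x,0)=p_0(x)$ and $u(x,0)=p_0(x)/Z_-$. Then for every $t\ge0$ and every $x\in[0,x_+]$ the two series $\sum_{m\ge0}w^1_{2m+1}(x,t)$ and $\sum_{m\ge0}w^2_{2m}(x,t)$ converge, and $$p(x,t)=\sum_{m=0}^\infty w^1_{2m+1}(x,t)+\sum_{m=0}^\infty w^2_{2m}(x,t).$$ In particular, $p(0,t)-p_0(-c_-t)=\sum_{m\ge0}R_{2m+1}(t)$ and $p(x_+,t)=\sum_{m\ge0}T_{2m}(t)$.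
   Context: Setting. Fix $x_+>0$. Let $K,\rho:\mathbb R\to(0,\infty)$ be continuous, constant $(K_-,\rho_-)$ on $(-\infty,0)$, constant $(K_+,\rho_+)$ on $(x_+,\infty)$, and continuously differentiable on $[0,x_+]$. Define $Z=\sqrt{K\rho}$ and $c=\sqrt{K/\rho}$, with constant values $Z_\pm$, $c_\pm$ outside $[0,x_+]$. Let $r(x)=Z'(x)/(2Z(x))$ on $[0,x_+]$, $\tau(x)=\int_0^x ds/c(s)$, and $C_G(x)=\sqrt{Z(x)/Z_-}$. A sequence $\mathbf x=(x_1,\dots,x_n)$ is alternating if $x_1\ge x_2\le x_3\ge\cdots$, that is, $x_j\le x_{j-1}$ for even $j\ge2$ and $x_j\ge x_{j-1}$ for odd $j\ge3$. Let $\mathcal P_n^{[0,x_+]}$ be the set of alternating $\mathbf x\in[0,x_+]^n$, and put $\hat t(\mathbf x)=2\sum_{j=1}^n(-1)^{j+1}\tau(x_j)$. Define $$\xi_R(\mathbf x,x,t)=-c_-(t-\hat t(\mathbf x)+\tau(x)),\qquad \xi_T(\mathbf x,x,t)=-c_-(t-\hat t(\mathbf x)-\tau(x)).$$ For $x\in[0,x_+]$ and $m\ge0$ define $$w^1_{2m+1}(x,t)=(-1)^mC_G(x)\int_{\mathcal P_{2m}^{[0,x_+]}}\prod_{j=1}^{2m}r(x_j)\int_{\max(x,x_{2m})}^{x_+}p_0\bigl(\xi_R((x_1,\dots,x_{2m+1}),x,t)\bigr)r(x_{2m+1})\,dx_{2m+1}\,dx_1\cdots dx_{2m}.$$ For $m=0$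 read $\max(x,x_0)$ as $x$ and drop the outer integral. For $m\ge1$ define $$w^2_{2m}(x,t)=(-1)^mC_G(x)\int_{\mathcal P_{2m-1}^{[0,x_+]}}\prod_{j=1}^{2m-1}r(x_j)\int_0^{\min(x,x_{2m-1})}p_0\bigl(\xi_T((x_1,\dots,x_{2m}),x,t)\bigr)r(x_{2m})\,dx_{2m}\,dx_1\cdots dx_{2m-1},$$ and set $w^2_0(x,t)=C_G(x)\,p_0(-c_-(t-\tau(x)))$. Finally, $R_{2m+1}(t):=w^1_{2m+1}(0,t)$ and $T_{2m}(t):=w^2_{2m}(x_+,t)$. *)

theory Defs
  imports "HOL-Analysis.Analysis"
begin

text \<open>Coefficients. Z = sqrt(K rho), c = sqrt(K / rho). The constant values
  Z_-, c_- on the left half-line are read off at the point -1.\<close>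

definition Zf :: "(real \<Rightarrow> real) \<Rightarrow> (real \<Rightarrow> real) \<Rightarrow> real \<Rightarrow> real" where
  "Zf K \<rho> x = sqrt (K x * \<rho> x)"

definition cf :: "(real \<Rightarrow> real) \<Rightarrow> (real \<Rightarrow> real) \<Rightarrow> real \<Rightarrow> real" where
  "cf K \<rho> x = sqrt (K x / \<rho> x)"

definition Zm :: "(real \<Rightarrow> real) \<Rightarrow> (real \<Rightarrow> real) \<Rightarrow> real" where
  "Zm K \<rho> = Zf K \<rho> (-1)"

definition cm :: "(real \<Rightarrow> real) \<Rightarrow> (real \<Rightarrow> real) \<Rightarrow> real" where
  "cm K \<rho> = cf K \<rho> (-1)"

definition rf :: "(real \<Rightarrow> real) \<Rightarrow> (real \<Rightarrow> real) \<Rightarrow> real \<Rightarrow> real \<Rightarrow> real" where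
  "rf K \<rho> xp x = vector_derivative (Zf K \<rho>) (at x within {0..xp}) / (2 * Zf K \<rho> x)"

definition tau :: "(real \<Rightarrow> real) \<Rightarrow> (real \<Rightarrow> real) \<Rightarrow> real \<Rightarrow> real" where
  "tau K \<rho> x = integral {0..x} (\<lambda>s. 1 / cf K \<rho> s)"

definition CG :: "(real \<Rightarrow> real) \<Rightarrow> (real \<Rightarrow> real) \<Rightarrow> real \<Rightarrow> real" where
  "CG K \<rho> x = sqrt (Zf K \<rho> x / Zm K \<rho>)"

definition alternating :: "nat \<Rightarrow> (nat \<Rightarrow> real) \<Rightarrow> bool" where
  "alternating n xs \<longleftrightarrow>
     (\<forall>j\<in>{2..n}. if even j then xs j \<le> xs (j - 1) else xs (j - 1) \<le> xs j)"

definition Pset :: "real \<Rightarrow> nat \<Rightarrow> (nat \<Rightarrow> real) set" where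
  "Pset xp n = {xs \<in> PiE {1..n} (\<lambda>_. {0..xp}). alternating n xs}"

definition that :: "(real \<Rightarrow> real) \<Rightarrow> (real \<Rightarrow> real) \<Rightarrow> nat \<Rightarrow> (nat \<Rightarrow> real) \<Rightarrow> real" where
  "that K \<rho> n xs = 2 * (\<Sum>j=1..n. (-1) ^ (j + 1) * tau K \<rho> (xs j))"

definition xiR :: "(real \<Rightarrow> real) \<Rightarrow> (real \<Rightarrow> real) \<Rightarrow> nat \<Rightarrow> (nat \<Rightarrow> real) \<Rightarrow> real \<Rightarrow> real \<Rightarrow> real" where
  "xiR K \<rho> n xs x t = - cm K \<rho> * (t - that K \<rho> n xs + tau K \<rho> x)"

definition xiT :: "(real \<Rightarrow> real) \<Rightarrow> (real \<Rightarrow> real) \<Rightarrow> nat \<Rightarrow> (nat \<Rightarrow> real) \<Rightarrow> real \<Rightarrow> real \<Rightarrow> real" where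
  "xiT K \<rho> n xs x t = - cm K \<rho> * (t - that K \<rho> n xs - tau K \<rho> x)"

abbreviation seqM :: "nat \<Rightarrow> (nat \<Rightarrow> real) measure" where
  "seqM n \<equiv> PiM {1..n} (\<lambda>_. lborel)"

definition w1 :: "(real \<Rightarrow> real) \<Rightarrow> (real \<Rightarrow> real) \<Rightarrow> real \<Rightarrow> (real \<Rightarrow> real) \<Rightarrow> nat \<Rightarrow> real \<Rightarrow> real \<Rightarrow> real" where
  "w1 K \<rho> xp p0 m x t =
     (-1) ^ m * CG K \<rho> x *
     (\<integral>xs \<in> Pset xp (2*m).
        (\<Prod>j\<in>{1..2*m}. rf K \<rho> xp (xs j)) *
        (\<integral>y \<in> {(if m = 0 then x else max x (xs (2*m)))..xp}.
            p0 (xiR K \<rho> (2*m+1) (xs(2*m+1 := y)) x t) * rf K \<rho> xp y \<partial>lborel)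
      \<partial>seqM (2*m))"

definition w2 :: "(real \<Rightarrow> real) \<Rightarrow> (real \<Rightarrow> real) \<Rightarrow> real \<Rightarrow> (real \<Rightarrow> real) \<Rightarrow> nat \<Rightarrow> real \<Rightarrow> real \<Rightarrow> real" where
  "w2 K \<rho> xp p0 m x t =
     (if m = 0 then CG K \<rho> x * p0 (- cm K \<rho> * (t - tau K \<rho> x))
      else (-1) ^ m * CG K \<rho> x *
       (\<integral>xs \<in> Pset xp (2*m-1).
          (\<Prod>j\<in>{1..2*m-1}. rf K \<rho> xp (xs j)) *
          (\<integral>y \<in> {0..min x (xs (2*m-1))}.
              p0 (xiT K \<rho> (2*m) (xs(2*m := y)) x t) * rf K \<rho> xp y \<partial>lborel)
        \<partial>seqM (2*m-1)))"

definition Rf where "Rf K \<rho> xp p0 m t = w1 K \<rho> xp p0 m 0 t"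
definition Tf where "Tf K \<rho> xp p0 m t = w2 K \<rho> xp p0 m xp t"

definition classical_solution ::
  "(real \<Rightarrow> real) \<Rightarrow> (real \<Rightarrow> real) \<Rightarrow> (real \<Rightarrow> real) \<Rightarrow> (real \<Rightarrow> real \<Rightarrow> real) \<Rightarrow> (real \<Rightarrow> real \<Rightarrow> real) \<Rightarrow> bool" where
  "classical_solution K \<rho> p0 p u \<longleftrightarrow>
    (\<exists>px pt ux ut :: real \<Rightarrow> real \<Rightarrow> real.
      (\<forall>x t. t > 0 \<longrightarrow>
          ((\<lambda>y. p y t) has_real_derivative px x t) (at x) \<and>
          ((\<lambda>s. p x s) has_real_derivative pt x t) (at t) \<and>
          ((\<lambda>y. u y t) has_real_derivative ux x t) (at x) \<and>
          ((\<lambda>s. u x s) has_real_derivative ut x t) (at t) \<and>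
          pt x t + K x * ux x t = 0 \<and>
          ut x t + px x t / \<rho> x = 0) \<and>
      continuous_on {z. snd z > 0} (\<lambda>z. px (fst z) (snd z)) \<and>
      continuous_on {z. snd z > 0} (\<lambda>z. pt (fst z) (snd z)) \<and>
      continuous_on {z. snd z > 0} (\<lambda>z. ux (fst z) (snd z)) \<and>
      continuous_on {z. snd z > 0} (\<lambda>z. ut (fst z) (snd z))) \<and>
    continuous_on {z. snd z \<ge> 0} (\<lambda>z. p (fst z) (snd z)) \<and>
    continuous_on {z. snd z \<ge> 0} (\<lambda>z. u (fst z) (snd z)) \<and>
    (\<forall>x. p x 0 = p0 x \<and> u x 0 = p0 x / Zm K \<rho>)"

end

(* Dividing the Riemann invariants (p +- Z u) / 2 by C_G gives amplitudes A and B with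
   A' = - r B along dx/dt = c and B' = - r A along dx/dt = -c. Since A(0,t) = p0(-c_- t),
   B(x_+,t) = 0 and both vanish at t = 0 on [0,x_+], integration along characteristics yields a
   fixed-point system for (A, B). By Fubini, w^1 / C_G and w^2 / C_G are its successive Picard
   increments, alternately left- and right-going. In the norm weighted by exp(- kappa t) each
   scattering is a contraction by 1/2, so the error of the partial sums tends to 0 and the series
   converge to A and B. *)
theory Submission
  imports Defs
begin

section \<open>Coefficients and travel time\<close>

text \<open>The recursion peels off the last turning point: the observation point \<open>x\<close>
  interacts only with it, so fixing it at \<open>y\<close> leaves a path integral with one turning
  point fewer, observed at \<open>y\<close> at the earlier time given by the characteristic from
  \<open>y\<close> to \<open>x\<close>. The left-going equation is integrated from its right end,
  which turns \<open>- r\<close> into \<open>+ r\<close>; only scatterings into the right-going wave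
  carry a minus, hence the sign \<open>(-1) ^ m\<close>. Since \<open>\<tau>' = 1 / c\<close>, a
  constant \<open>\<kappa>\<close> above \<open>2 * \<bar>r\<bar> * c\<close> gives
  \<open>\<bar>r\<bar> \<le> \<kappa> * \<tau>' / 2\<close>. The weighted integral along a
  characteristic is then dominated by half of an exact derivative, without any smallness of
  \<open>r\<close> or of the time. No term of the series is estimated: the errors of the partial
  sums solve the system without source, so one bound gives both convergence and the value of the
  limit. The obstacle is the line \<open>t = 0\<close>, where the solution is known only to be
  continuous. Characteristics are always followed to the end of the slab, into negative times if
  necessary, and the amplitudes are extended there by zero; each characteristic then has at most one
  exceptional point.\<close>

lemma has_real_derivative_along_curve:
  fixes f :: "real \<Rightarrow> real \<Rightarrow> real"
  assumes fx: "((\<lambda>y. f y t) has_real_derivative fx) (at x)"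
    and ft: "\<And>y s. s > 0 \<Longrightarrow> ((\<lambda>s. f y s) has_real_derivative ft y s) (at s)"
    and cont: "continuous_on {z. snd z > 0} (\<lambda>z. ft (fst z) (snd z))"
    and \<gamma>: "(\<gamma> has_real_derivative \<gamma>') (at x)" "\<gamma> x = t" and t: "t > 0"
  shows "((\<lambda>y. f y (\<gamma> y)) has_real_derivative (fx + ft x t * \<gamma>')) (at x)"
proof -
  let ?S = "UNIV \<times> {0<..} :: (real \<times> real) set"
  have S: "?S = {z. snd z > 0}" by auto
  have op: "open ?S" by (intro open_Times) auto
  \<comment> \<open>Total differentiability follows from the \<open>x\<close>-derivative at the
    single point and a continuous time derivative. The time derivative is written as a bounded
    linear map because its continuity is required in operator norm.\<close>
  have "((\<lambda>(x, y). f x y) has_derivative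
      (\<lambda>(tx, ty). fx * tx + blinfun_scaleR_left (ft x t) ty)) (at (x, t) within ?S)"
  proof (rule has_derivative_partialsI)
    show "((\<lambda>x. f x t) has_derivative (*) fx) (at x within UNIV)"
      using fx by (simp add: has_field_derivative_def)
    show "((\<lambda>s. f y s) has_derivative blinfun_apply (blinfun_scaleR_left (ft y s)))
        (at s within {0<..})" if "s \<in> {0<..}" for y s
    proof -
      have "blinfun_apply (blinfun_scaleR_left (ft y s)) = (*) (ft y s)"
        by (auto simp: mult.commute)
      then show ?thesis
        using ft[of s y] that by (simp add: has_field_derivative_def has_derivative_at_withinI)
    qed
    have "continuous_on ?S (\<lambda>z. blinfun_scaleR_left (ft (fst z) (snd z)))"
      using cont unfolding S by (intro bounded_linear.continuous_on[OF bounded_linear_blinfun_scaleR_left])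
    then show "continuous (at (x, t) within ?S) (\<lambda>(x, y). blinfun_scaleR_left (ft x y))"
      using t by (simp add: continuous_on_eq_continuous_within split_beta')
  qed (use t in auto)
  then have D: "((\<lambda>(x, y). f x y) has_derivative (\<lambda>(tx, ty). fx * tx + ty * ft x t)) (at (x, \<gamma> x))"
    using op t \<gamma>(2) by (subst (asm) at_within_open) auto
  have "((\<lambda>y. (y, \<gamma> y)) has_derivative (\<lambda>h. (h, \<gamma>' * h))) (at x)"
    using \<gamma>(1) unfolding has_field_derivative_def by (intro has_derivative_Pair) auto
  from diff_chain_at[OF this D] show ?thesis
    unfolding has_field_derivative_def
    by (simp add: o_def) (erule has_derivative_eq_rhs, auto simp: algebra_simps)
qed

lemma constant_extends_left:
  fixes f :: "real \<Rightarrow> real"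
  assumes "continuous_on UNIV f" "\<And>x. x < a \<Longrightarrow> f x = C" "x \<le> a"
  shows "f x = C"
  using continuous_constant_on_closure[of "{..<a}" f C x] assms
  by (auto simp: closure_lessThan intro: continuous_on_subset)

lemma constant_extends_right:
  fixes f :: "real \<Rightarrow> real"
  assumes "continuous_on UNIV f" "\<And>x. x > a \<Longrightarrow> f x = C" "x \<ge> a"
  shows "f x = C"
  using continuous_constant_on_closure[of "{a<..}" f C x] assms
  by (auto simp: closure_greaterThan intro: continuous_on_subset)

locale layered_medium =
  fixes K \<rho> :: "real \<Rightarrow> real" and xp Km \<rho>m Kp \<rho>p :: real
  assumes xp: "xp > 0"
    and Kpos: "\<And>x. K x > 0" and \<rho>pos: "\<And>x. \<rho> x > 0"
    and Kcont: "continuous_on UNIV K" and \<rho>cont: "continuous_on UNIV \<rho>"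
    and Kleft: "\<And>x. x < 0 \<Longrightarrow> K x = Km" and \<rho>left: "\<And>x. x < 0 \<Longrightarrow> \<rho> x = \<rho>m"
    and Kright: "\<And>x. x > xp \<Longrightarrow> K x = Kp" and \<rho>right: "\<And>x. x > xp \<Longrightarrow> \<rho> x = \<rho>p"
    and KC1: "\<exists>K'. (\<forall>x\<in>{0..xp}. (K has_real_derivative K' x) (at x within {0..xp}))
                  \<and> continuous_on {0..xp} K'"
    and \<rho>C1: "\<exists>\<rho>'. (\<forall>x\<in>{0..xp}. (\<rho> has_real_derivative \<rho>' x) (at x within {0..xp}))
                  \<and> continuous_on {0..xp} \<rho>'"
begin

abbreviation "Z \<equiv> Zf K \<rho>"
abbreviation "c \<equiv> cf K \<rho>"
abbreviation "\<tau> \<equiv> tau K \<rho>"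
abbreviation "r \<equiv> rf K \<rho> xp"
abbreviation "G \<equiv> CG K \<rho>"

lemma Z_pos: "Z x > 0" and c_pos: "c x > 0"
  by (simp_all add: Zf_def cf_def Kpos \<rho>pos)

lemma G_pos: "G x > 0"
  by (simp add: CG_def Zm_def Z_pos)

text \<open>These relations between modulus, density, impedance and speed make the equations for
  \<open>p\<close> and \<open>u\<close> combine into transport at speed \<open>c\<close> or
  \<open>- c\<close>.\<close>

lemma K_eq: "K x = c x * Z x" and Z_eq: "Z x = c x * \<rho> x"
proof -
  have "sqrt (K x) * sqrt (K x) = K x" "sqrt (\<rho> x) * sqrt (\<rho> x) = \<rho> x" "sqrt (\<rho> x) \<noteq> 0"
    using Kpos[of x] \<rho>pos[of x] by auto
  then show "K x = c x * Z x" "Z x = c x * \<rho> x"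
    unfolding cf_def Zf_def by (simp_all add: real_sqrt_mult real_sqrt_divide field_simps)
qed

lemma Z_cont: "continuous_on UNIV Z" and c_cont: "continuous_on UNIV c"
proof -
  have "\<rho> x \<noteq> 0" for x using \<rho>pos[of x] by simp
  then show "continuous_on UNIV Z" "continuous_on UNIV c"
    unfolding Zf_def[abs_def] cf_def[abs_def]
    using Kcont \<rho>cont by (auto intro!: continuous_intros)
qed

lemma G_cont: "continuous_on UNIV G"
  unfolding CG_def[abs_def] using Z_cont Z_pos[of "-1"]
  by (intro continuous_intros) (auto simp: Zm_def)

lemma Z_left: "x \<le> 0 \<Longrightarrow> Z x = Zm K \<rho>"
  by (rule constant_extends_left[OF Z_cont, of 0]) (simp_all add: Zf_def Zm_def Kleft \<rho>left)

lemma c_left: "x \<le> 0 \<Longrightarrow> c x = cm K \<rho>"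
  by (rule constant_extends_left[OF c_cont, of 0]) (simp_all add: cf_def cm_def Kleft \<rho>left)

lemma Z_right: "x \<ge> xp \<Longrightarrow> Z x = Z (xp + 1)"
  by (rule constant_extends_right[OF Z_cont, of xp]) (simp_all add: Zf_def Kright \<rho>right)

lemma c_right: "x \<ge> xp \<Longrightarrow> c x = c (xp + 1)"
  by (rule constant_extends_right[OF c_cont, of xp]) (simp_all add: cf_def Kright \<rho>right)

lemma G_0 [simp]: "G 0 = 1"
  using Z_pos[of "-1"] Z_left[of 0] by (simp add: CG_def Zm_def)

lemma Z_deriv:
  "x \<in> {0..xp} \<Longrightarrow> (Z has_real_derivative 2 * Z x * r x) (at x within {0..xp})"
  and r_cont: "continuous_on {0..xp} r"
proof -
  obtain K' \<rho>' where
    K': "\<And>x. x \<in> {0..xp} \<Longrightarrow> (K has_real_derivative K' x) (at x within {0..xp})"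
      "continuous_on {0..xp} K'" and
    \<rho>': "\<And>x. x \<in> {0..xp} \<Longrightarrow> (\<rho> has_real_derivative \<rho>' x) (at x within {0..xp})"
      "continuous_on {0..xp} \<rho>'"
    using KC1 \<rho>C1 by blast
  define Z' where "Z' x = (K' x * \<rho> x + \<rho>' x * K x) / (2 * Z x)" for x
  have D: "(Z has_real_derivative Z' x) (at x within {0..xp})" if "x \<in> {0..xp}" for x
    unfolding Zf_def[abs_def] Z'_def
    using K'(1)[OF that] \<rho>'(1)[OF that] mult_pos_pos[OF Kpos[of x] \<rho>pos[of x]]
    by (auto intro!: derivative_eq_intros simp: field_simps)
  \<comment> \<open>Derivatives within a nondegenerate interval are unique, also at its end points,
    so the \<open>vector_derivative\<close> inside \<open>r\<close> is the one computed by the chain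
    rule.\<close>
  have r: "r x = Z' x / (2 * Z x)" if "x \<in> {0..xp}" for x
    using vector_derivative_within_closed_interval[OF xp that, of Z "Z' x"] D[OF that]
    by (simp add: rf_def has_real_derivative_iff_has_vector_derivative)
  show "(Z has_real_derivative 2 * Z x * r x) (at x within {0..xp})" if "x \<in> {0..xp}"
    using D[OF that] r[OF that] Z_pos[of x] by simp
  have "continuous_on {0..xp} (\<lambda>x. Z' x / (2 * Z x))"
    unfolding Z'_def
    using K'(2) \<rho>'(2) continuous_on_subset[OF Kcont] continuous_on_subset[OF \<rho>cont]
      continuous_on_subset[OF Z_cont] Z_pos
    by (intro continuous_intros) (auto simp: less_imp_neq[symmetric])
  then show "continuous_on {0..xp} r"
    by (rule continuous_on_eq) (simp add: r)
qed

lemma Z_deriv_interior: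
  assumes "0 < x" "x < xp"
  shows "(Z has_real_derivative 2 * Z x * r x) (at x)"
  using Z_deriv[of x] assms at_within_Icc_at[of 0 x xp] by simp

text \<open>\<open>G\<close> is the square root of \<open>Z\<close> up to a constant, so its
  logarithmic derivative is half that of \<open>Z\<close>, namely \<open>r\<close>. This choice
  makes division by \<open>G\<close> cancel the self-coupling of each amplitude.\<close>

lemma G_deriv_interior:
  assumes "0 < x" "x < xp"
  shows "(G has_real_derivative G x * r x) (at x)"
proof -
  have "((\<lambda>x. sqrt (Z x / Zm K \<rho>)) has_real_derivative
      2 * Z x * r x / Zm K \<rho> * (inverse (sqrt (Z x / Zm K \<rho>)) / 2)) (at x)"
    using Z_deriv_interior[OF assms] divide_pos_pos[OF Z_pos[of x] Z_pos[of "-1"]] Z_pos[of "-1"]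
    by (auto intro!: derivative_eq_intros simp: Zm_def)
  also have "2 * Z x * r x / Zm K \<rho> * (inverse (sqrt (Z x / Zm K \<rho>)) / 2)
      = r x * ((Z x / Zm K \<rho>) / G x)"
    by (simp add: CG_def field_simps)
  also have "(Z x / Zm K \<rho>) / G x = G x"
    using Z_pos[of x] Z_pos[of "-1"] unfolding CG_def Zm_def by (intro real_div_sqrt) simp
  finally show ?thesis by (simp add: CG_def[abs_def] mult.commute)
qed

section \<open>Travel time and its level sets\<close>

lemma slowness_cont: "continuous_on A (\<lambda>s. 1 / c s)"
  using continuous_on_subset[OF c_cont] c_pos
  by (intro continuous_intros) (auto simp: less_imp_neq[symmetric])

lemma tau_deriv:
  assumes "x \<in> {0..a}"
  shows "(\<tau> has_real_derivative 1 / c x) (at x within {0..a})"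
  using integral_has_real_derivative[OF slowness_cont assms] by (simp add: tau_def[abs_def])

lemma tau_deriv_pos:
  assumes "0 < x"
  shows "(\<tau> has_real_derivative 1 / c x) (at x)"
  using tau_deriv[of x "x + 1"] assms at_within_Icc_at[of 0 x "x + 1"] by simp

lemma tau_cont: "continuous_on {0..a} \<tau>"
  using tau_deriv by (meson DERIV_continuous_on)

lemma tau_0 [simp]: "\<tau> 0 = 0"
  by (simp add: tau_def)

lemma tau_less:
  assumes "0 \<le> x" "x < y"
  shows "\<tau> x < \<tau> y"
proof (rule DERIV_pos_imp_increasing_open[OF assms(2)])
  show "\<exists>d. (\<tau> has_real_derivative d) (at z) \<and> 0 < d" if "x < z" "z < y" for z
    using tau_deriv_pos[of z] c_pos[of z] that assms by (intro exI[of _ "1 / c z"]) simp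
  show "continuous_on {x..y} \<tau>"
    using assms by (intro continuous_on_subset[OF tau_cont[of y]]) simp
qed

text \<open>Negative arguments are included, where the interval of integration is empty and
  \<open>\<tau>\<close> is 0; global monotonicity gives Borel measurability on the whole
  line.\<close>

lemma tau_mono: "mono \<tau>"
proof (rule monoI)
  fix x y :: real assume "x \<le> y"
  then show "\<tau> x \<le> \<tau> y"
    using slowness_cont[THEN integrable_continuous_real] c_pos unfolding tau_def
    by (intro integral_subset_le) (auto simp: less_imp_le)
qed

lemma tau_measurable [measurable]: "\<tau> \<in> borel_measurable borel"
  by (rule borel_measurable_mono[OF tau_mono])

lemma tau_inj: "0 \<le> x \<Longrightarrow> 0 \<le> y \<Longrightarrow> \<tau> x = \<tau> y \<Longrightarrow> x = y"
  using tau_less by (metis less_irrefl linorder_less_linear)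

text \<open>A characteristic meets \<open>t = 0\<close> on a level set of \<open>\<tau>\<close>.
  Finiteness makes this set admissible as the exceptional set of the fundamental theorem of
  calculus.\<close>

lemma finite_tau_level: "finite {y. 0 \<le> y \<and> \<tau> y = a}"
proof (cases "\<exists>y\<ge>0. \<tau> y = a")
  case True
  then obtain y where "0 \<le> y" "\<tau> y = a" by auto
  then have "{y. 0 \<le> y \<and> \<tau> y = a} \<subseteq> {y}"
    using tau_inj by auto
  then show ?thesis by (rule finite_subset) simp
next
  case False
  then have "{y. 0 \<le> y \<and> \<tau> y = a} = {}" by auto
  then show ?thesis by (metis finite.emptyI)
qed

end

section \<open>Characteristics\<close>

locale scattering = layered_medium +
  fixes p0 :: "real \<Rightarrow> real" and p u :: "real \<Rightarrow> real \<Rightarrow> real"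
  assumes p0_cont: "continuous_on UNIV p0" and p0bdd: "bounded (range p0)"
    and p0zero: "\<And>\<xi>. \<xi> \<ge> 0 \<Longrightarrow> p0 \<xi> = 0"
    and sol: "classical_solution K \<rho> p0 p u"
begin

text \<open>For \<open>\<epsilon> = 1\<close> the right-going and for \<open>\<epsilon> = - 1\<close> the left-going amplitude; the prefactor
  \<open>1 / C\<^sub>G\<close> removes the diagonal coupling. Clamping time at 0 extends both by zero to
  negative times on \<open>[0, x\<^sub>+]\<close>, where the initial data vanish.\<close>

definition amp :: "real \<Rightarrow> real \<Rightarrow> real \<Rightarrow> real" where
  "amp \<epsilon> x t = (p x (max t 0) + \<epsilon> * Z x * u x (max t 0)) / (2 * G x)"

lemma p_eq_amp: "t \<ge> 0 \<Longrightarrow> p x t = G x * (amp 1 x t + amp (-1) x t)"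
  using G_pos[of x] by (simp add: amp_def field_simps)

section \<open>Continuity of the amplitudes and their derivatives along characteristics\<close>

lemma p_cont: "continuous_on {z. snd z \<ge> 0} (\<lambda>z. p (fst z) (snd z))"
  and u_cont: "continuous_on {z. snd z \<ge> 0} (\<lambda>z. u (fst z) (snd z))"
  using sol unfolding classical_solution_def by auto

lemma amp_cont: "continuous_on UNIV (\<lambda>z. amp \<epsilon> (fst z) (snd z))"
proof -
  have clamp: "continuous_on UNIV (\<lambda>z::real \<times> real. f (fst z) (max (snd z) 0))"
    if "continuous_on {z. snd z \<ge> 0} (\<lambda>z. f (fst z) (snd z))" for f :: "real \<Rightarrow> real \<Rightarrow> real"
    by (rule continuous_on_compose2[OF that, where f = "\<lambda>z. (fst z, max (snd z) 0)", simplified])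
       (auto intro!: continuous_intros)
  have "continuous_on UNIV (\<lambda>z::real \<times> real. f (fst z))" if "continuous_on UNIV f" for f :: "real \<Rightarrow> real"
    by (rule continuous_on_compose2[OF that]) (auto intro!: continuous_intros)
  note fst_cont = this[OF Z_cont] this[OF G_cont]
  have "G x \<noteq> 0" for x using G_pos[of x] by simp
  then show ?thesis
    unfolding amp_def using fst_cont clamp[OF p_cont] clamp[OF u_cont]
    by (intro continuous_on_divide continuous_on_add continuous_on_mult continuous_on_const) auto
qed

lemma amp_cont_comp [continuous_intros]:
  assumes "continuous_on A f" "continuous_on A g"
  shows "continuous_on A (\<lambda>y. amp \<epsilon> (f y) (g y))"
  by (rule continuous_on_compose2[OF amp_cont, where f = "\<lambda>y. (f y, g y)", simplified])
     (intro continuous_intros assms)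

lemma amp_nonpos_time: "0 \<le> x \<Longrightarrow> t \<le> 0 \<Longrightarrow> amp \<epsilon> x t = 0"
  using sol p0zero by (simp add: amp_def classical_solution_def max_absorb2)

text \<open>Along a characteristic the derivatives of \<open>p\<close> and \<open>u\<close> cancel
  by the two equations, and only the variation of the impedance remains. \<open>Z'\<close> is a
  parameter because the formula serves the slab, with \<open>2 * Z x * r x\<close>, and the
  homogeneous half-lines, with 0.\<close>

lemma riemann_deriv:
  assumes \<epsilon>: "\<epsilon> = 1 \<or> \<epsilon> = -1"
    and Z: "(Z has_real_derivative Z') (at x)"
    and \<gamma>: "(\<gamma> has_real_derivative \<epsilon> / c x) (at x)" "\<gamma> x > 0"
  shows "((\<lambda>y. p y (\<gamma> y) + \<epsilon> * Z y * u y (\<gamma> y)) has_real_derivative \<epsilon> * Z' * u x (\<gamma> x)) (at x)"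
proof -
  obtain px pt ux ut where
    d: "\<And>x t. t > 0 \<Longrightarrow> ((\<lambda>y. p y t) has_real_derivative px x t) (at x)"
       "\<And>x t. t > 0 \<Longrightarrow> ((\<lambda>s. p x s) has_real_derivative pt x t) (at t)"
       "\<And>x t. t > 0 \<Longrightarrow> ((\<lambda>y. u y t) has_real_derivative ux x t) (at x)"
       "\<And>x t. t > 0 \<Longrightarrow> ((\<lambda>s. u x s) has_real_derivative ut x t) (at t)" and
    eq: "\<And>x t. t > 0 \<Longrightarrow> pt x t + K x * ux x t = 0"
        "\<And>x t. t > 0 \<Longrightarrow> ut x t + px x t / \<rho> x = 0" and
    cont: "continuous_on {z. snd z > 0} (\<lambda>z. pt (fst z) (snd z))"
          "continuous_on {z. snd z > 0} (\<lambda>z. ut (fst z) (snd z))"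
    using sol unfolding classical_solution_def by blast
  let ?t = "\<gamma> x"
  have P: "((\<lambda>y. p y (\<gamma> y)) has_real_derivative (px x ?t + pt x ?t * (\<epsilon> / c x))) (at x)"
    by (rule has_real_derivative_along_curve[OF d(1) d(2) cont(1) \<gamma>(1)]) (use \<gamma>(2) in auto)
  have U: "((\<lambda>y. u y (\<gamma> y)) has_real_derivative (ux x ?t + ut x ?t * (\<epsilon> / c x))) (at x)"
    by (rule has_real_derivative_along_curve[OF d(3) d(4) cont(2) \<gamma>(1)]) (use \<gamma>(2) in auto)
  have "((\<lambda>y. p y (\<gamma> y) + \<epsilon> * Z y * u y (\<gamma> y)) has_real_derivative
      (px x ?t + pt x ?t * (\<epsilon> / c x)) +
      (\<epsilon> * Z' * u x ?t + (ux x ?t + ut x ?t * (\<epsilon> / c x)) * (\<epsilon> * Z x))) (at x)"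
    using P U Z by (auto intro!: derivative_eq_intros)
  moreover have "pt x ?t = - (c x * Z x * ux x ?t)"
    using eq(1)[OF \<gamma>(2), of x] K_eq[of x] by simp
  moreover have "ut x ?t * Z x = - (c x * px x ?t)"
  proof -
    have "px x ?t = - (\<rho> x * ut x ?t)"
      using eq(2)[OF \<gamma>(2), of x] \<rho>pos[of x] by (simp add: field_simps)
    then show ?thesis by (simp add: Z_eq)
  qed
  ultimately show ?thesis
    using \<epsilon> c_pos[of x] by (auto simp: field_simps)
qed

text \<open>At positive times the quotient rule leaves only the opposite amplitude. At negative
  times both sides are 0, the left one because the curve stays below \<open>t = 0\<close> nearby.
  The crossing itself is excluded, as clamping may produce a kink there.\<close>

lemma amp_deriv:
  assumes \<epsilon>: "\<epsilon> = 1 \<or> \<epsilon> = -1" and x: "0 < x" "x < xp"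
    and \<gamma>: "(\<gamma> has_real_derivative \<epsilon> / c x) (at x)" "\<gamma> x \<noteq> 0"
  shows "((\<lambda>y. amp \<epsilon> y (\<gamma> y)) has_real_derivative - r x * amp (- \<epsilon>) x (\<gamma> x)) (at x)"
proof (cases "\<gamma> x > 0")
  case True
  have "isCont \<gamma> x"
    using \<gamma>(1) DERIV_isCont by blast
  then have pos: "\<forall>\<^sub>F y in at x. \<gamma> y > 0"
    using True by (auto simp: isCont_def dest: order_tendstoD)
  have "((\<lambda>y. (p y (\<gamma> y) + \<epsilon> * Z y * u y (\<gamma> y)) / (2 * G y)) has_real_derivative
      (\<epsilon> * (2 * Z x * r x) * u x (\<gamma> x) * (2 * G x) -
        (p x (\<gamma> x) + \<epsilon> * Z x * u x (\<gamma> x)) * (2 * (G x * r x))) / (2 * G x * (2 * G x))) (at x)"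
    using G_pos[of x]
    by (intro DERIV_divide riemann_deriv[OF \<epsilon> Z_deriv_interior[OF x] \<gamma>(1) True]
        DERIV_cmult G_deriv_interior[OF x]) auto
  also have "(\<epsilon> * (2 * Z x * r x) * u x (\<gamma> x) * (2 * G x) -
        (p x (\<gamma> x) + \<epsilon> * Z x * u x (\<gamma> x)) * (2 * (G x * r x))) / (2 * G x * (2 * G x)) =
      - r x * amp (- \<epsilon>) x (\<gamma> x)"
    using G_pos[of x] True by (simp add: amp_def max_absorb1 field_simps)
  finally have D: "((\<lambda>y. (p y (\<gamma> y) + \<epsilon> * Z y * u y (\<gamma> y)) / (2 * G y)) has_real_derivative
      - r x * amp (- \<epsilon>) x (\<gamma> x)) (at x)" .
  have "\<forall>\<^sub>F y in nhds x. (p y (\<gamma> y) + \<epsilon> * Z y * u y (\<gamma> y)) / (2 * G y) = amp \<epsilon> y (\<gamma> y)"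
    using pos True by (auto simp: eventually_nhds_conv_at amp_def max_absorb1 elim: eventually_mono)
  from DERIV_cong_ev[OF refl this refl, THEN iffD1, OF D] show ?thesis .
next
  case False
  have "isCont \<gamma> x"
    using \<gamma>(1) DERIV_isCont by blast
  then have neg: "\<forall>\<^sub>F y in at x. \<gamma> y < 0"
    using False \<gamma>(2) by (auto simp: isCont_def intro: order_tendstoD)
  have "\<forall>\<^sub>F y in nhds x. y > 0"
    using x eventually_nhds_in_open[of "{0<..}" x] by simp
  moreover have "\<forall>\<^sub>F y in nhds x. \<gamma> y < 0"
    using neg False \<gamma>(2) by (auto simp: eventually_nhds_conv_at)
  ultimately have "\<forall>\<^sub>F y in nhds x. 0 = amp \<epsilon> y (\<gamma> y)"
    by eventually_elim (simp add: amp_nonpos_time)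
  from DERIV_cong_ev[OF refl this refl, THEN iffD1, OF DERIV_const] show ?thesis
    using amp_nonpos_time[of x "\<gamma> x" "- \<epsilon>"] x False by simp
qed

text \<open>In a homogeneous region the invariant has derivative 0 along a straight characteristic.
  Time may reach 0 at an end point, where only continuity is available; the mean value argument asks
  for no more.\<close>

lemma riemann_const:
  assumes \<epsilon>: "\<epsilon> = 1 \<or> \<epsilon> = -1" and ab: "a < b"
    and Z: "\<And>x. x \<in> {a..b} \<Longrightarrow> Z x = z" and c: "\<And>x. x \<in> {a..b} \<Longrightarrow> c x = k"
    and \<gamma>: "\<And>x. a < x \<Longrightarrow> x < b \<Longrightarrow> s + \<epsilon> * x / k > 0"
      "s + \<epsilon> * a / k \<ge> 0" "s + \<epsilon> * b / k \<ge> 0"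
  shows "p a (s + \<epsilon> * a / k) + \<epsilon> * z * u a (s + \<epsilon> * a / k) =
         p b (s + \<epsilon> * b / k) + \<epsilon> * z * u b (s + \<epsilon> * b / k)"
proof -
  have k: "k > 0" using c[of a] ab c_pos[of a] by simp
  let ?f = "\<lambda>y. p y (s + \<epsilon> * y / k) + \<epsilon> * z * u y (s + \<epsilon> * y / k)"
  have pos: "s + \<epsilon> * x / k \<ge> 0" if "x \<in> {a..b}" for x
    using \<gamma>(1)[of x] \<gamma>(2,3) that by (cases "x = a"; cases "x = b") (auto intro: less_imp_le)
  have "?f b = ?f a"
  proof (rule DERIV_isconst_end[OF ab])
    have comp: "continuous_on {a..b} (\<lambda>y. f y (s + \<epsilon> * y / k))"
      if "continuous_on {z. snd z \<ge> 0} (\<lambda>z. f (fst z) (snd z))" for f :: "real \<Rightarrow> real \<Rightarrow> real"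
      by (rule continuous_on_compose2[OF that, where f = "\<lambda>y. (y, s + \<epsilon> * y / k)", simplified])
         (use pos k in \<open>auto intro!: continuous_intros\<close>)
    show "continuous_on {a..b} ?f"
      by (intro continuous_on_add continuous_on_mult continuous_on_const comp[OF p_cont] comp[OF u_cont])
  next
    fix x assume x: "a < x" "x < b"
    have nb: "\<forall>\<^sub>F y in nhds x. y \<in> {a<..<b}"
      using x by (intro eventually_nhds_in_open) auto
    then have "\<forall>\<^sub>F y in nhds x. z = Z y"
      by eventually_elim (simp add: Z)
    from DERIV_cong_ev[OF refl this refl, THEN iffD1, OF DERIV_const]
    have "(Z has_real_derivative 0) (at x)" .
    moreover have "((\<lambda>y. s + \<epsilon> * y / k) has_real_derivative \<epsilon> / c x) (at x)"
      using c[of x] x k by (auto intro!: derivative_eq_intros)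
    ultimately have D: "((\<lambda>y. p y (s + \<epsilon> * y / k) + \<epsilon> * Z y * u y (s + \<epsilon> * y / k))
        has_real_derivative 0) (at x)"
      using riemann_deriv[OF \<epsilon>, of 0 x "\<lambda>y. s + \<epsilon> * y / k"] \<gamma>(1)[OF x] by simp
    have "\<forall>\<^sub>F y in nhds x. p y (s + \<epsilon> * y / k) + \<epsilon> * Z y * u y (s + \<epsilon> * y / k) = ?f y"
      using nb by eventually_elim (simp add: Z)
    from DERIV_cong_ev[OF refl this refl, THEN iffD1, OF D]
    show "(?f has_real_derivative 0) (at x)" .
  qed
  then show ?thesis by simp
qed

text \<open>The right-going characteristic through \<open>(0, t)\<close> starts at
  \<open>- cm K \<rho> * t\<close>, where the choice \<open>u = p0 / Zm\<close> makes the initial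
  invariant \<open>2 * p0\<close>. For \<open>t \<le> 0\<close> both sides vanish.\<close>

lemma amp_left_boundary: "amp 1 0 t = p0 (- cm K \<rho> * t)"
proof (cases "t > 0")
  case True
  define k where "k = cm K \<rho>"
  have k: "k > 0" by (simp add: k_def cm_def c_pos)
  have "p (- k * t) (t + 1 * (- k * t) / k) + 1 * Zm K \<rho> * u (- k * t) (t + 1 * (- k * t) / k) =
      p 0 (t + 1 * 0 / k) + 1 * Zm K \<rho> * u 0 (t + 1 * 0 / k)"
    by (rule riemann_const) (use True k Z_left c_left in \<open>auto simp: k_def field_simps\<close>)
  then show ?thesis
    using sol True k Z_left[of 0] Z_pos[of "-1"]
    by (simp add: amp_def classical_solution_def k_def max_absorb1 Zm_def)
next
  case False
  then show ?thesis
    using amp_nonpos_time[of 0 t 1] c_pos[of "-1"]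
    by (simp add: p0zero cm_def mult_nonneg_nonpos mult_le_0_iff)
qed

text \<open>The left-going characteristic through \<open>(xp, t)\<close> starts at time 0 at a point
  to the right of the slab, where the initial data vanish: nothing enters from the right.\<close>

lemma amp_right_boundary: "amp (-1) xp t = 0"
proof (cases "t > 0")
  case True
  define k where "k = c (xp + 1)"
  \<comment> \<open>This offset places the line \<open>s - x / k\<close> at time \<open>t\<close>
    for \<open>x = xp\<close>, and at time 0 for \<open>x = xp + k * t\<close>.\<close>
  define s where "s = t + xp / k"
  have k: "k > 0" by (simp add: k_def c_pos)
  have "p xp (s + (-1) * xp / k) + (-1) * Z (xp + 1) * u xp (s + (-1) * xp / k) =
      p (xp + k * t) (s + (-1) * (xp + k * t) / k)
        + (-1) * Z (xp + 1) * u (xp + k * t) (s + (-1) * (xp + k * t) / k)"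
  proof (rule riemann_const)
    show "Z x = Z (xp + 1)" "c x = k" if "x \<in> {xp..xp + k * t}" for x
      using Z_right[of x] c_right[of x] that by (simp_all only: k_def atLeastAtMost_iff)
    show "s + (-1) * x / k > 0" if "xp < x" "x < xp + k * t" for x
    proof -
      have "s + (-1) * x / k = (xp + k * t - x) / k"
        using k by (simp add: s_def field_simps)
      then show ?thesis using that k by simp
    qed
  qed (use True k in \<open>auto simp: s_def field_simps\<close>)
  moreover have "s + (-1) * xp / k = t" "s + (-1) * (xp + k * t) / k = 0"
    using k by (simp_all add: s_def field_simps)
  moreover have "xp + k * t \<ge> 0"
    using xp k True by simp
  ultimately have "p xp t - Z xp * u xp t = 0"
    using sol p0zero Z_right[of xp] by (simp add: classical_solution_def)
  then show ?thesis
    using True by (simp add: amp_def max_absorb1)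
qed (use xp amp_nonpos_time in simp)

section \<open>The fixed-point system along characteristics\<close>

lemma right_going_integral_equation:
  assumes x: "x \<in> {0..xp}"
  shows "amp 1 x t = p0 (- cm K \<rho> * (t - \<tau> x)) -
    (\<integral>y\<in>{0..x}. r y * amp (-1) y (t - \<tau> x + \<tau> y) \<partial>lborel)"
    and "set_integrable lborel {0..x} (\<lambda>y. r y * amp (-1) y (t - \<tau> x + \<tau> y))"
proof -
  let ?\<gamma> = "\<lambda>y. t - \<tau> x + \<tau> y"
  have \<gamma>: "continuous_on {0..x} ?\<gamma>"
    by (intro continuous_intros tau_cont)
  \<comment> \<open>This level is the place where the characteristic crosses \<open>t = 0\<close>.
    The amplitude is continuous there, so the fundamental theorem tolerates the missing
    derivative.\<close>
  from finite_tau_level[of "\<tau> x - t"]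
  have "((\<lambda>y. - r y * amp (-1) y (?\<gamma> y)) has_integral
      (amp 1 x (?\<gamma> x) - amp 1 0 (?\<gamma> 0))) {0..x}"
  proof (rule fundamental_theorem_of_calculus_interior_strong)
    fix y assume y: "y \<in> {0<..<x} - {y. 0 \<le> y \<and> \<tau> y = \<tau> x - t}"
    then have "(?\<gamma> has_real_derivative 1 / c y) (at y)"
      by (auto intro!: derivative_eq_intros tau_deriv_pos)
    moreover have "?\<gamma> y \<noteq> 0"
      using y by auto
    ultimately show "((\<lambda>y. amp 1 y (?\<gamma> y)) has_vector_derivative - r y * amp (-1) y (?\<gamma> y)) (at y)"
      using amp_deriv[of 1 y ?\<gamma>] y x
      by (simp add: has_real_derivative_iff_has_vector_derivative[symmetric])
  qed (use x \<gamma> in \<open>auto intro!: continuous_intros\<close>)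
  then have I: "integral {0..x} (\<lambda>y. r y * amp (-1) y (?\<gamma> y)) = amp 1 0 (t - \<tau> x) - amp 1 x t"
    by (auto dest!: has_integral_neg integral_unique)
  have "continuous_on {0..x} (\<lambda>y. r y * amp (-1) y (?\<gamma> y))"
    using x by (intro continuous_intros \<gamma> continuous_on_subset[OF r_cont]) auto
  from borel_integrable_atLeastAtMost'[OF this]
  show si: "set_integrable lborel {0..x} (\<lambda>y. r y * amp (-1) y (?\<gamma> y))" .
  show "amp 1 x t = p0 (- cm K \<rho> * (t - \<tau> x)) -
    (\<integral>y\<in>{0..x}. r y * amp (-1) y (t - \<tau> x + \<tau> y) \<partial>lborel)"
    unfolding set_borel_integral_eq_integral(2)[OF si] I amp_left_boundary by simp
qed

text \<open>The boundary term sits at \<open>xp\<close> and is 0. Solving for the value at the lower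
  end point reverses the sign of \<open>- r\<close>.\<close>

lemma left_going_integral_equation:
  assumes x: "x \<in> {0..xp}"
  shows "amp (-1) x t = (\<integral>y\<in>{x..xp}. r y * amp 1 y (t + \<tau> x - \<tau> y) \<partial>lborel)"
    and "set_integrable lborel {x..xp} (\<lambda>y. r y * amp 1 y (t + \<tau> x - \<tau> y))"
proof -
  let ?\<gamma> = "\<lambda>y. t + \<tau> x - \<tau> y"
  have \<gamma>: "continuous_on {x..xp} ?\<gamma>"
    using x by (intro continuous_intros continuous_on_subset[OF tau_cont[of xp]]) auto
  from finite_tau_level[of "t + \<tau> x"]
  have "((\<lambda>y. - r y * amp 1 y (?\<gamma> y)) has_integral
      (amp (-1) xp (?\<gamma> xp) - amp (-1) x (?\<gamma> x))) {x..xp}"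
  proof (rule fundamental_theorem_of_calculus_interior_strong)
    fix y assume y: "y \<in> {x<..<xp} - {y. 0 \<le> y \<and> \<tau> y = t + \<tau> x}"
    then have "(?\<gamma> has_real_derivative - 1 / c y) (at y)"
      using x by (auto intro!: derivative_eq_intros tau_deriv_pos)
    moreover have "?\<gamma> y \<noteq> 0"
      using x y by auto
    ultimately show "((\<lambda>y. amp (-1) y (?\<gamma> y)) has_vector_derivative - r y * amp 1 y (?\<gamma> y)) (at y)"
      using amp_deriv[of "-1" y ?\<gamma>] y x
      by (simp add: has_real_derivative_iff_has_vector_derivative[symmetric])
  qed (use x \<gamma> in \<open>auto intro!: continuous_intros\<close>)
  then have I: "integral {x..xp} (\<lambda>y. r y * amp 1 y (?\<gamma> y)) = amp (-1) x t"
    by (auto dest!: has_integral_neg integral_unique simp: amp_right_boundary)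
  have "continuous_on {x..xp} (\<lambda>y. r y * amp 1 y (?\<gamma> y))"
    using x by (intro continuous_intros \<gamma> continuous_on_subset[OF r_cont]) auto
  from borel_integrable_atLeastAtMost'[OF this]
  show si: "set_integrable lborel {x..xp} (\<lambda>y. r y * amp 1 y (?\<gamma> y))" .
  show "amp (-1) x t = (\<integral>y\<in>{x..xp}. r y * amp 1 y (t + \<tau> x - \<tau> y) \<partial>lborel)"
    unfolding set_borel_integral_eq_integral(2)[OF si] I by simp
qed

end

section \<open>Recursion for the iterated integrals\<close>

lemma that_Suc_upd:
  "that K \<rho> (Suc n) (xs(Suc n := y)) = that K \<rho> n xs + 2 * (-1) ^ n * tau K \<rho> y"
proof -
  have "(\<Sum>j=1..n. (-1) ^ (j + 1) * tau K \<rho> ((xs(Suc n := y)) j)) =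
        (\<Sum>j=1..n. (-1) ^ (j + 1) * tau K \<rho> (xs j))"
    by (intro sum.cong) auto
  then show ?thesis
    by (simp add: that_def algebra_simps)
qed

text \<open>Only the comparison of the new entry with entry \<open>n\<close> is added. The update
  forgets the old value at \<open>Suc n\<close>, which membership of \<open>xs\<close> requires to
  be \<open>undefined\<close>; hence the extensionality assumption.\<close>

lemma Pset_Suc_upd:
  assumes "xs \<in> extensional {1..n}"
  shows "xs(Suc n := z) \<in> Pset L (Suc n) \<longleftrightarrow>
    xs \<in> Pset L n \<and> z \<in> {0..L} \<and> (n \<ge> 1 \<longrightarrow> (if odd n then z \<le> xs n else xs n \<le> z))"
proof -
  have I: "{1..Suc n} = insert (Suc n) {1..n}"
    and J: "{2..Suc n} = (if n \<ge> 1 then insert (Suc n) {2..n} else {})"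
    by auto
  have "xs(Suc n := z) \<in> extensional (insert (Suc n) {1..n})"
    using assms by (simp add: extensional_def)
  moreover have "(\<forall>i\<in>{1..n}. (xs(Suc n := z)) i \<in> {0..L}) \<longleftrightarrow> (\<forall>i\<in>{1..n}. xs i \<in> {0..L})"
    by (intro ball_cong) auto
  ultimately have PiE: "xs(Suc n := z) \<in> PiE {1..Suc n} (\<lambda>_. {0..L}) \<longleftrightarrow>
      xs \<in> PiE {1..n} (\<lambda>_. {0..L}) \<and> z \<in> {0..L}"
    using assms unfolding I PiE_iff by (simp only: ball_simps) auto
  have "(\<forall>j\<in>{2..n}. if even j then (xs(Suc n := z)) j \<le> (xs(Suc n := z)) (j - 1)
          else (xs(Suc n := z)) (j - 1) \<le> (xs(Suc n := z)) j) \<longleftrightarrow>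
        (\<forall>j\<in>{2..n}. if even j then xs j \<le> xs (j - 1) else xs (j - 1) \<le> xs j)"
    by (intro ball_cong) auto
  then have "alternating (Suc n) (xs(Suc n := z)) \<longleftrightarrow>
      alternating n xs \<and> (n \<ge> 1 \<longrightarrow> (if odd n then z \<le> xs n else xs n \<le> z))"
    unfolding alternating_def J by (cases "n \<ge> 1") auto
  then show ?thesis
    using PiE by (auto simp: Pset_def)
qed

lemma Pset_0: "Pset L 0 = {\<lambda>_. undefined}"
  by (auto simp: Pset_def alternating_def)

lemma Pset_subset_PiE: "Pset L n \<subseteq> PiE {1..n} (\<lambda>_. {0..L})"
  by (auto simp: Pset_def)

lemma Pset_measurable: "Pset L n \<in> sets (seqM n)"
proof -
  have "Pset L n = PiE {1..n} (\<lambda>_. {0..L}) \<inter>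
      {xs \<in> space (seqM n). \<forall>j\<in>{2..n}. if even j then xs j \<le> xs (j - 1) else xs (j - 1) \<le> xs j}"
    by (auto simp: Pset_def alternating_def space_PiM PiE_iff extensional_def)
  also have "\<dots> \<in> sets (seqM n)"
  proof (intro sets.Int sets_PiM_I_finite sets.sets_Collect_finite_All)
    fix j assume "j \<in> {2..n}"
    then have "(\<lambda>xs. xs j) \<in> borel_measurable (seqM n)"
      "(\<lambda>xs. xs (j - 1)) \<in> borel_measurable (seqM n)"
      by (auto intro!: measurable_component_singleton[of _ _ "\<lambda>_. lborel", simplified])
    then show "{xs \<in> space (seqM n). if even j then xs j \<le> xs (j - 1) else xs (j - 1) \<le> xs j} \<in> sets (seqM n)"
      using borel_measurable_le by (cases "even j") simp_all
  qed auto
  finally show ?thesis .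
qed

context layered_medium
begin

section \<open>One path integral for reflected and transmitted waves\<close>

definition turning_range :: "nat \<Rightarrow> real \<Rightarrow> (nat \<Rightarrow> real) \<Rightarrow> real set" where
  "turning_range n x xs =
     (if odd n then {(if n = 1 then x else max x (xs (n - 1)))..xp} else {0..min x (xs (n - 1))})"

text \<open>The parity of \<open>n\<close> selects the wave: \<open>- (-1) ^ n * \<tau> x\<close>
  yields the phase \<open>xiR\<close> for odd and \<open>xiT\<close> for even \<open>n\<close>. It
  is meant for \<open>n \<ge> 1\<close>; the signs \<open>(-1) ^ m\<close> and the factor
  \<open>G\<close> are kept outside.\<close>

definition path_integral :: "(real \<Rightarrow> real) \<Rightarrow> nat \<Rightarrow> real \<Rightarrow> real \<Rightarrow> real" where
  "path_integral f n x t =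
     (\<integral>xs\<in>Pset xp (n - 1). (\<Prod>j\<in>{1..n-1}. r (xs j)) *
        (\<integral>y\<in>turning_range n x xs.
           f (- cm K \<rho> * (t - that K \<rho> n (xs(n := y)) - (-1) ^ n * \<tau> x)) * r y \<partial>lborel)
      \<partial>seqM (n - 1))"

lemma turning_range_odd:
  "turning_range (2 * m + 1) x xs = {(if m = 0 then x else max x (xs (2 * m)))..xp}"
  by (cases m) (simp_all add: turning_range_def)

lemma path_integral_1:
  "path_integral f (Suc 0) x t = (\<integral>y\<in>{x..xp}. f (- cm K \<rho> * (t + \<tau> x - 2 * \<tau> y)) * r y \<partial>lborel)"
proof -
  interpret product_sigma_finite "\<lambda>_. lborel :: real measure" ..
  have "(\<Prod>j\<in>{1..Suc 0 - 1}. r (xs j)) = 1"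
    "that K \<rho> (Suc 0) (xs(Suc 0 := y)) = 2 * \<tau> y"
    "turning_range (Suc 0) x xs = {x..xp}" for xs :: "nat \<Rightarrow> real" and y
    by (simp_all add: that_def turning_range_def)
  then have "path_integral f (Suc 0) x t =
      (\<integral>xs. indicator {\<lambda>_. undefined} xs *
        (\<integral>y\<in>{x..xp}. f (- cm K \<rho> * (t + \<tau> x - 2 * \<tau> y)) * r y \<partial>lborel) \<partial>seqM 0)"
    unfolding path_integral_def set_lebesgue_integral_def[of "seqM _"]
    by (simp add: Pset_0 algebra_simps)
  \<comment> \<open>The product measure over the empty index set is a unit point mass at the
    everywhere undefined function.\<close>
  also have "\<dots> = (\<integral>y\<in>{x..xp}. f (- cm K \<rho> * (t + \<tau> x - 2 * \<tau> y)) * r y \<partial>lborel)"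
    by (simp add: measure_def space_PiM)
  finally show ?thesis .
qed

lemma w1_eq: "w1 K \<rho> xp f m x t = (-1) ^ m * G x * path_integral f (2 * m + 1) x t"
  by (simp only: w1_def path_integral_def turning_range_odd xiR_def) simp

lemma w2_eq: "m > 0 \<Longrightarrow> w2 K \<rho> xp f m x t = (-1) ^ m * G x * path_integral f (2 * m) x t"
  by (simp add: w2_def path_integral_def turning_range_def xiT_def)


lemma turning_range_subset: "x \<in> {0..xp} \<Longrightarrow> turning_range n x xs \<subseteq> {0..xp}"
  by (auto simp: turning_range_def)

text \<open>The inequality between the last two turning points \<open>z\<close> and \<open>y\<close>
  is moved from the range of \<open>y\<close> to that of \<open>z\<close>. Then \<open>y\<close>
  plays for the shorter path the role that \<open>x\<close> had for the longer one.\<close>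

lemma turning_range_swap:
  assumes x: "x \<in> {0..xp}" and xs: "xs \<in> Pset xp k"
  shows "xs(Suc k := z) \<in> Pset xp (Suc k) \<and> y \<in> turning_range (Suc (Suc k)) x (xs(Suc k := z)) \<longleftrightarrow>
    y \<in> (if odd k then {x..xp} else {0..x}) \<and> z \<in> turning_range (Suc k) y xs"
proof -
  have "xs \<in> PiE {1..k} (\<lambda>_. {0..xp})"
    using xs Pset_subset_PiE by blast
  then have ext: "xs \<in> extensional {1..k}" and k: "k \<ge> 1 \<Longrightarrow> xs k \<in> {0..xp}"
    by (auto simp: PiE_iff)
  show ?thesis
    unfolding Pset_Suc_upd[OF ext] using x xs k
    by (cases "k = 0"; cases "odd k") (auto simp: turning_range_def)
qed

lemma r_bounded: obtains R where "R > 0" "\<And>x. x \<in> {0..xp} \<Longrightarrow> \<bar>r x\<bar> \<le> R"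
proof -
  have "bounded (r ` {0..xp})"
    by (intro compact_imp_bounded compact_continuous_image r_cont) auto
  then obtain R where "R > 0" "\<forall>y\<in>r ` {0..xp}. norm y \<le> R"
    by (auto simp: bounded_pos)
  then show ?thesis using that by auto
qed

text \<open>Fubini brings the last turning point \<open>y\<close> to the outside. With
  \<open>xs\<close> a path of \<open>Suc k\<close> turning points, the phase regroups as that of
  \<open>xs\<close> observed at \<open>y\<close>, at a time earlier by the travel time between
  \<open>x\<close> and \<open>y\<close>.\<close>

lemma path_integral_Suc:
  fixes f :: "real \<Rightarrow> real" and k :: nat and x t :: real
  assumes x: "x \<in> {0..xp}" and f [measurable]: "f \<in> borel_measurable borel"
    and bdd: "bounded (range f)"
  defines "S \<equiv> if odd k then {x..xp} else {0..x}"
  defines "F \<equiv> \<lambda>y. r y * path_integral f (Suc k) y (t - (-1) ^ k * (\<tau> x - \<tau> y))"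
  shows "set_integrable lborel S F" (is ?integrable)
    and "path_integral f (Suc (Suc k)) x t = (\<integral>y\<in>S. F y \<partial>lborel)" (is ?eq)
proof -
  obtain R where R: "R > 0" "\<And>x. x \<in> {0..xp} \<Longrightarrow> \<bar>r x\<bar> \<le> R"
    using r_bounded by blast
  obtain B where B: "B > 0" "\<And>s. \<bar>f s\<bar> \<le> B"
    using bdd by (auto simp: bounded_pos)
  let ?I = "{1..Suc k}" and ?M = "seqM (Suc k)"
  interpret product_sigma_finite "\<lambda>_. lborel :: real measure" ..
  interpret M: finite_product_sigma_finite "\<lambda>_. lborel :: real measure" ?I
    by standard simp
  interpret P: pair_sigma_finite ?M lborel ..
  define phase where
    "phase xs y = - cm K \<rho> * (t - that K \<rho> (Suc k) xs + (-1) ^ k * (2 * \<tau> y - \<tau> x))" for xs y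
  let ?T = "turning_range (Suc (Suc k)) x"
  \<comment> \<open>The whole integrand with all constraints as indicators, so that both orders of
    integration run over full spaces.\<close>
  define h where "h xs y = indicator (Pset xp (Suc k)) xs * (\<Prod>j\<in>?I. r (xs j)) *
      (indicator (?T xs) y * (f (phase xs y) * r y))" for xs y
  \<comment> \<open>Outside the slab nothing is known about \<open>r\<close>; its truncation is
    bounded and Borel, and agrees with \<open>r\<close> wherever \<open>h\<close> is
    nonzero.\<close>
  define r' where "r' y = indicator {0..xp} y * r y" for y
  have r' [measurable]: "r' \<in> borel_measurable borel"
    using borel_measurable_continuous_on_indicator[OF _ r_cont] xp
    by (simp add: r'_def[abs_def])
  have r'_le: "\<bar>r' y\<bar> \<le> R" for y
    using R by (simp add: r'_def indicator_def)
  have h_eq: "h xs y = indicator (Pset xp (Suc k)) xs * (\<Prod>j\<in>?I. r' (xs j)) *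
      (indicator (?T xs) y * (f (phase xs y) * r' y))" for xs y
  proof (cases "xs \<in> Pset xp (Suc k) \<and> y \<in> ?T xs")
    case True
    then have "xs \<in> PiE ?I (\<lambda>_. {0..xp})" "y \<in> {0..xp}"
      using Pset_subset_PiE turning_range_subset[OF x] by blast+
    then have "(\<Prod>j\<in>?I. r (xs j)) = (\<Prod>j\<in>?I. r' (xs j))" "r y = r' y"
      by (auto simp: r'_def PiE_iff intro!: prod.cong)
    then show ?thesis by (simp add: h_def)
  qed (auto simp: h_def)
  have h_bound: "\<bar>h xs y\<bar> \<le> R ^ Suc k * (B * R)" for xs y
  proof -
    have "\<bar>\<Prod>j\<in>?I. r' (xs j)\<bar> \<le> (\<Prod>j\<in>?I. R)"
      unfolding abs_prod by (intro prod_mono) (simp add: r'_le)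
    then have "\<bar>indicator (Pset xp (Suc k)) xs * (\<Prod>j\<in>?I. r' (xs j))\<bar> \<le> R ^ Suc k"
      using R(1) by (auto simp: indicator_def)
    moreover have "\<bar>indicator (?T xs) y * (f (phase xs y) * r' y)\<bar> \<le> B * R"
      using B R r'_le by (auto simp: indicator_def abs_mult intro!: mult_mono)
    ultimately show ?thesis
      unfolding h_eq abs_mult[of "indicator (Pset xp (Suc k)) xs * _"] using R(1)
      by (intro mult_mono) auto
  qed
  have h_supp: "h xs y = 0" if "xs \<notin> PiE ?I (\<lambda>_. {0..xp}) \<or> y \<notin> {0..xp}" for xs y
    using that Pset_subset_PiE[of xp "Suc k"] turning_range_subset[OF x, of "Suc (Suc k)" xs]
    by (auto simp: h_def indicator_def)
  have comp [measurable]: "(\<lambda>z. fst z j) \<in> borel_measurable (?M \<Otimes>\<^sub>M lborel)" if "j \<in> ?I" for j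
    using measurable_compose[OF measurable_fst measurable_component_singleton[OF that, of "\<lambda>_. lborel"]]
    by simp
  have h_meas: "(\<lambda>(xs, y). h xs y) \<in> borel_measurable (?M \<Otimes>\<^sub>M lborel)"
  proof -
    have [measurable]: "Pset xp (Suc k) \<in> sets ?M"
      by (rule Pset_measurable)
    have [measurable]: "(\<lambda>z. that K \<rho> (Suc k) (fst z)) \<in> borel_measurable (?M \<Otimes>\<^sub>M lborel)"
      unfolding that_def by (intro borel_measurable_times borel_measurable_const borel_measurable_sum
          measurable_compose[OF comp tau_measurable])
    have [measurable]: "(\<lambda>z. \<Prod>j\<in>?I. r' (fst z j)) \<in> borel_measurable (?M \<Otimes>\<^sub>M lborel)"
      by (intro borel_measurable_prod measurable_compose[OF comp r'])
    have [measurable]: "(\<lambda>z. fst z (Suc k)) \<in> borel_measurable (?M \<Otimes>\<^sub>M lborel)"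
      by (rule comp) simp
    have T: "indicator (?T xs) y = (if odd k then (if x \<le> y \<and> xs (Suc k) \<le> y \<and> y \<le> xp then 1 else 0)
        else (if 0 \<le> y \<and> y \<le> x \<and> y \<le> xs (Suc k) then 1 else 0 :: real))" for xs y
      by (auto simp: turning_range_def indicator_def)
    show ?thesis
      unfolding h_eq T phase_def split_beta' by measurable
  qed
  have box: "emeasure ?M (PiE ?I (\<lambda>_. {0..xp})) < \<infinity>"
    using xp by (subst M.measure_times) (auto simp: ennreal_power ennreal_mult_less_top)
  have "integrable (?M \<Otimes>\<^sub>M lborel) (\<lambda>(xs, y). h xs y)"
  \<comment> \<open>A bounded integrand supported in a box of finite measure: \<open>Suc k\<close>
    factors of \<open>r\<close> from \<open>xs\<close>, then the bound \<open>B\<close> of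
    \<open>f\<close> and one more factor for \<open>y\<close>.\<close>
  proof (rule integrableI_bounded_set[where A = "PiE ?I (\<lambda>_. {0..xp}) \<times> {0..xp}" and B = "R ^ Suc k * (B * R)"])
    show "emeasure (?M \<Otimes>\<^sub>M lborel) (PiE ?I (\<lambda>_. {0..xp}) \<times> {0..xp}) < \<infinity>"
      using box xp by (subst lborel.emeasure_pair_measure_Times) (auto intro!: sets_PiM_I_finite simp: ennreal_mult_less_top)
    show "AE z in ?M \<Otimes>\<^sub>M lborel. z \<notin> PiE ?I (\<lambda>_. {0..xp}) \<times> {0..xp} \<longrightarrow> (case z of (xs, y) \<Rightarrow> h xs y) = 0"
      by (intro AE_I2) (clarsimp simp only: split_beta' mem_Times_iff de_Morgan_conj h_supp)
  qed (use h_meas h_bound in \<open>auto intro!: pair_measureI sets_PiM_I_finite\<close>)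
  note Fub = P.Fubini_integral[OF this] P.integrable_snd[OF this]
  have slice: "(\<integral>xs. h xs y \<partial>?M) = indicator S y * F y" for y
  proof -
    have "(\<lambda>xs. h xs y) \<in> borel_measurable ?M"
      using measurable_compose[OF measurable_Pair2' h_meas, of y] by simp
    then have "integrable ?M (\<lambda>xs. h xs y)"
      by (intro integrableI_bounded_set[where A = "PiE ?I (\<lambda>_. {0..xp})" and B = "R ^ Suc k * (B * R)"])
        (use box h_bound h_supp in \<open>auto intro!: sets_PiM_I_finite\<close>)
    moreover have ins: "?I = insert (Suc k) {1..k}"
      by auto
    \<comment> \<open>With \<open>y\<close> fixed, coordinate \<open>Suc k\<close> is split off the
      product measure; it becomes the inner variable of the shorter path integral.\<close>
    ultimately have "(\<integral>xs. h xs y \<partial>?M) = (\<integral>xs. (\<integral>z. h (xs(Suc k := z)) y \<partial>lborel) \<partial>seqM k)"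
      unfolding ins by (intro product_integral_insert) auto
    also have "\<dots> = (\<integral>xs. indicator S y * r y * (indicator (Pset xp k) xs * ((\<Prod>j\<in>{1..k}. r (xs j)) *
        (\<integral>z. indicator (turning_range (Suc k) y xs) z * (f (- cm K \<rho> * (t - (-1) ^ k * (\<tau> x - \<tau> y)
          - that K \<rho> (Suc k) (xs(Suc k := z)) - (-1) ^ Suc k * \<tau> y)) * r z) \<partial>lborel))) \<partial>seqM k)"
    proof (rule Bochner_Integration.integral_cong[OF refl])
      fix xs assume "xs \<in> space (seqM k)"
      then have ext: "xs \<in> extensional {1..k}"
        by (simp add: space_PiM PiE_iff)
      have prod: "(\<Prod>j\<in>?I. r ((xs(Suc k := z)) j)) = r z * (\<Prod>j\<in>{1..k}. r (xs j))" for z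
        unfolding ins by (subst prod.insert) (auto intro!: prod.cong)
      have "h (xs(Suc k := z)) y = indicator S y * r y * (indicator (Pset xp k) xs * ((\<Prod>j\<in>{1..k}. r (xs j)) *
        (indicator (turning_range (Suc k) y xs) z * (f (- cm K \<rho> * (t - (-1) ^ k * (\<tau> x - \<tau> y)
          - that K \<rho> (Suc k) (xs(Suc k := z)) - (-1) ^ Suc k * \<tau> y)) * r z))))" for z
      proof (cases "xs \<in> Pset xp k")
        case True
        have "phase (xs(Suc k := z)) y = - cm K \<rho> * (t - (-1) ^ k * (\<tau> x - \<tau> y)
          - that K \<rho> (Suc k) (xs(Suc k := z)) - (-1) ^ Suc k * \<tau> y)"
          by (simp add: phase_def algebra_simps)
        moreover have "indicator (Pset xp (Suc k)) (xs(Suc k := z)) * indicator (?T (xs(Suc k := z))) y =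
            indicator S y * (indicator (turning_range (Suc k) y xs) z :: real)"
          unfolding S_def indicator_def of_bool_conj[symmetric] turning_range_swap[OF x True] ..
        ultimately show ?thesis
          using True unfolding h_def prod by (simp add: mult_ac)
      next
        case False
        then show ?thesis
          using Pset_Suc_upd[OF ext] by (simp add: h_def)
      qed
      then show "(\<integral>z. h (xs(Suc k := z)) y \<partial>lborel) = indicator S y * r y * (indicator (Pset xp k) xs * ((\<Prod>j\<in>{1..k}. r (xs j)) *
        (\<integral>z. indicator (turning_range (Suc k) y xs) z * (f (- cm K \<rho> * (t - (-1) ^ k * (\<tau> x - \<tau> y)
          - that K \<rho> (Suc k) (xs(Suc k := z)) - (-1) ^ Suc k * \<tau> y)) * r z) \<partial>lborel)))"
        by (simp only: integral_mult_right_zero)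
    qed
    also have "\<dots> = indicator S y * F y"
      by (simp only: integral_mult_right_zero F_def path_integral_def set_lebesgue_integral_def
          real_scaleR_def diff_Suc_1 mult.assoc)
    finally show ?thesis .
  qed
  show ?integrable
    using Fub(2) unfolding slice set_integrable_def by simp
  have "path_integral f (Suc (Suc k)) x t = (\<integral>xs. (\<integral>y. h xs y \<partial>lborel) \<partial>?M)"
  proof -
    have ph: "- cm K \<rho> * (t - that K \<rho> (Suc (Suc k)) (xs(Suc (Suc k) := y)) - (-1) ^ Suc (Suc k) * \<tau> x) =
        phase xs y" for xs y
      by (simp add: that_Suc_upd phase_def algebra_simps)
    show ?thesis
      unfolding path_integral_def set_lebesgue_integral_def ph h_def
      by (simp only: integral_mult_right_zero real_scaleR_def diff_Suc_1 mult.assoc)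
  qed
  also have "\<dots> = (\<integral>y. (\<integral>xs. h xs y \<partial>?M) \<partial>lborel)"
    by (rule Fub(1)[symmetric])
  finally show ?eq
    unfolding slice set_lebesgue_integral_def by simp
qed

end

section \<open>Convergence\<close>

context scattering
begin

definition right_term :: "nat \<Rightarrow> real \<Rightarrow> real \<Rightarrow> real" where
  "right_term m x t = (if m = 0 then p0 (- cm K \<rho> * (t - \<tau> x))
     else (-1) ^ m * path_integral p0 (2 * m) x t)"

definition left_term :: "nat \<Rightarrow> real \<Rightarrow> real \<Rightarrow> real" where
  "left_term m x t = (-1) ^ m * path_integral p0 (2 * m + 1) x t"

lemma w1_eq_left_term: "w1 K \<rho> xp p0 m x t = G x * left_term m x t"
  by (simp add: w1_eq left_term_def)

lemma w2_eq_right_term: "w2 K \<rho> xp p0 m x t = G x * right_term m x t"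
  by (cases "m = 0") (simp_all add: w2_eq right_term_def, simp add: w2_def)

lemma p0_measurable: "p0 \<in> borel_measurable borel"
  using p0_cont by (rule borel_measurable_continuous_onI)

text \<open>For \<open>m = 0\<close> the source is the incident wave, which is not a path integral,
  so the single reflection is computed directly. For larger \<open>m\<close> the recursion for path
  integrals applies with odd \<open>k\<close>.\<close>

lemma left_term_eq:
  assumes x: "x \<in> {0..xp}"
  shows "left_term m x t = (\<integral>y\<in>{x..xp}. r y * right_term m y (t + \<tau> x - \<tau> y) \<partial>lborel)"
    and "set_integrable lborel {x..xp} (\<lambda>y. r y * right_term m y (t + \<tau> x - \<tau> y))"
proof -
  have "left_term m x t = (\<integral>y\<in>{x..xp}. r y * right_term m y (t + \<tau> x - \<tau> y) \<partial>lborel) \<and>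
    set_integrable lborel {x..xp} (\<lambda>y. r y * right_term m y (t + \<tau> x - \<tau> y))"
  proof (cases m)
    case 0
    have "continuous_on {x..xp} (\<lambda>y. r y * p0 (- cm K \<rho> * (t + \<tau> x - \<tau> y - \<tau> y)))"
      using x by (intro continuous_intros continuous_on_compose2[OF p0_cont]
          continuous_on_subset[OF r_cont] continuous_on_subset[OF tau_cont[of xp]]) auto
    from borel_integrable_atLeastAtMost'[OF this] show ?thesis
      by (simp add: 0 left_term_def right_term_def path_integral_1 algebra_simps)
  next
    case (Suc k)
    note P = path_integral_Suc[OF x p0_measurable p0bdd, where k = "2 * k + 1" and t = t]
    have eq: "r y * right_term m y (t + \<tau> x - \<tau> y) =
        (-1) ^ m * (r y * path_integral p0 (Suc (2 * k + 1)) y (t - (-1) ^ (2 * k + 1) * (\<tau> x - \<tau> y)))" for y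
      by (simp add: right_term_def Suc algebra_simps)
    have "left_term m x t = (-1) ^ m * path_integral p0 (Suc (Suc (2 * k + 1))) x t"
      by (simp add: left_term_def Suc)
    then show ?thesis
      using P unfolding eq by (simp add: set_integral_mult_right set_integrable_mult_right)
  qed
  then show "left_term m x t = (\<integral>y\<in>{x..xp}. r y * right_term m y (t + \<tau> x - \<tau> y) \<partial>lborel)"
    "set_integrable lborel {x..xp} (\<lambda>y. r y * right_term m y (t + \<tau> x - \<tau> y))"
    by auto
qed

lemma right_term_Suc_eq:
  assumes x: "x \<in> {0..xp}"
  shows "right_term (Suc m) x t = - (\<integral>y\<in>{0..x}. r y * left_term m y (t - \<tau> x + \<tau> y) \<partial>lborel)"
    and "set_integrable lborel {0..x} (\<lambda>y. r y * left_term m y (t - \<tau> x + \<tau> y))"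
proof -
  note P = path_integral_Suc[OF x p0_measurable p0bdd, where k = "2 * m" and t = t]
  have eq: "r y * left_term m y (t - \<tau> x + \<tau> y) =
      (-1) ^ m * (r y * path_integral p0 (Suc (2 * m)) y (t - (-1) ^ (2 * m) * (\<tau> x - \<tau> y)))" for y
    by (simp add: left_term_def algebra_simps)
  have "right_term (Suc m) x t = - ((-1) ^ m * path_integral p0 (Suc (Suc (2 * m))) x t)"
    by (simp add: right_term_def)
  then show "right_term (Suc m) x t = - (\<integral>y\<in>{0..x}. r y * left_term m y (t - \<tau> x + \<tau> y) \<partial>lborel)"
    "set_integrable lborel {0..x} (\<lambda>y. r y * left_term m y (t - \<tau> x + \<tau> y))"
    using P unfolding eq by (simp_all add: set_integral_mult_right set_integrable_mult_right)
qed

section \<open>Errors of the partial sums and their decay\<close>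

definition right_error :: "nat \<Rightarrow> real \<Rightarrow> real \<Rightarrow> real" where
  "right_error n x t = amp 1 x t - (\<Sum>m<n. right_term m x t)"

definition left_error :: "nat \<Rightarrow> real \<Rightarrow> real \<Rightarrow> real" where
  "left_error n x t = amp (-1) x t - (\<Sum>m<n. left_term m x t)"

text \<open>Amplitudes and terms obey the same linear relation, so subtraction preserves it.
  Integrability is carried through the induction because splitting the integral of a difference
  needs it at each step.\<close>

lemma left_error_eq:
  assumes x: "x \<in> {0..xp}"
  shows "set_integrable lborel {x..xp} (\<lambda>y. r y * right_error n y (t + \<tau> x - \<tau> y)) \<and>
    left_error n x t = (\<integral>y\<in>{x..xp}. r y * right_error n y (t + \<tau> x - \<tau> y) \<partial>lborel)"
proof (induction n)
  case 0
  then show ?case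
    using left_going_integral_equation[OF x, of t] by (simp add: left_error_def right_error_def)
next
  case (Suc n)
  have "r y * right_error (Suc n) y s = r y * right_error n y s - r y * right_term n y s" for y s
    by (simp add: right_error_def algebra_simps)
  moreover have "left_error (Suc n) x t = left_error n x t - left_term n x t"
    by (simp add: left_error_def)
  ultimately show ?case
    using Suc left_term_eq[OF x, of n t] by (simp add: set_integral_diff)
qed

text \<open>The boundary source of the right-going equation is exactly \<open>right_term 0\<close>,
  hence the shift to \<open>Suc n\<close>: the first subtraction removes it and the relation becomes
  homogeneous.\<close>

lemma right_error_Suc_eq:
  assumes x: "x \<in> {0..xp}"
  shows "set_integrable lborel {0..x} (\<lambda>y. r y * left_error n y (t - \<tau> x + \<tau> y)) \<and>
    right_error (Suc n) x t = - (\<integral>y\<in>{0..x}. r y * left_error n y (t - \<tau> x + \<tau> y) \<partial>lborel)"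
proof (induction n)
  case 0
  then show ?case
    using right_going_integral_equation[OF x, of t]
    by (simp add: left_error_def right_error_def right_term_def)
next
  case (Suc n)
  have "r y * left_error (Suc n) y s = r y * left_error n y s - r y * left_term n y s" for y s
    by (simp add: left_error_def algebra_simps)
  moreover have "right_error (Suc (Suc n)) x t = right_error (Suc n) x t - right_term (Suc n) x t"
    by (simp add: right_error_def)
  ultimately show ?case
    using Suc right_term_Suc_eq[OF x, of n t] by (simp add: set_integral_diff)
qed

text \<open>The weight \<open>exp (\<kappa> t)\<close> turns one scattering into a contraction with factor \<open>1/2\<close>.\<close>

lemma weighted_scattering_bound:
  assumes ab: "0 \<le> a" "a \<le> b" "b \<le> xp" and \<epsilon>: "\<epsilon> = 1 \<or> \<epsilon> = -1"
    and int: "set_integrable lborel {a..b} (\<lambda>y. r y * g y)"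
    and g: "\<And>y. y \<in> {a..b} \<Longrightarrow> \<bar>g y\<bar> \<le> D * exp (\<kappa> * (s + \<epsilon> * \<tau> y))"
    and \<kappa>: "\<And>y. y \<in> {0..xp} \<Longrightarrow> \<bar>r y\<bar> * c y \<le> \<kappa> / 2"
  shows "\<bar>\<integral>y\<in>{a..b}. r y * g y \<partial>lborel\<bar> \<le>
    D / 2 * \<epsilon> * (exp (\<kappa> * (s + \<epsilon> * \<tau> b)) - exp (\<kappa> * (s + \<epsilon> * \<tau> a)))"
proof -
  let ?e = "\<lambda>y. exp (\<kappa> * (s + \<epsilon> * \<tau> y))"
  \<comment> \<open>The majorant is the exact derivative of \<open>D / 2 * \<epsilon> * exp
    (\<kappa> * (s + \<epsilon> * \<tau> y))\<close>, since
    \<open>\<epsilon> * \<epsilon> = 1\<close>.\<close>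
  have cont: "continuous_on {a..b} (\<lambda>y. D / 2 * (\<kappa> * (1 / c y)) * ?e y)"
    using ab by (intro continuous_intros slowness_cont continuous_on_subset[OF tau_cont[of b]]) auto
  have "((\<lambda>y. D / 2 * (\<kappa> * (1 / c y)) * ?e y) has_integral
      (D / 2 * \<epsilon> * ?e b - D / 2 * \<epsilon> * ?e a)) {a..b}"
  proof (rule fundamental_theorem_of_calculus[OF ab(2)])
    fix y assume y: "y \<in> {a..b}"
    then have "(\<tau> has_real_derivative 1 / c y) (at y within {a..b})"
      using ab tau_deriv[of y b] by (auto intro: DERIV_subset)
    then have "((\<lambda>y. D / 2 * \<epsilon> * ?e y) has_real_derivative D / 2 * (\<kappa> * (1 / c y)) * ?e y) (at y within {a..b})"
      using \<epsilon> by (auto intro!: derivative_eq_intros)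
    then show "((\<lambda>y. D / 2 * \<epsilon> * ?e y) has_vector_derivative D / 2 * (\<kappa> * (1 / c y)) * ?e y) (at y within {a..b})"
      by (simp add: has_real_derivative_iff_has_vector_derivative)
  qed
  then have val: "(\<integral>y\<in>{a..b}. D / 2 * (\<kappa> * (1 / c y)) * ?e y \<partial>lborel) = D / 2 * \<epsilon> * (?e b - ?e a)"
    using set_borel_integral_eq_integral(2)[OF borel_integrable_atLeastAtMost'[OF cont]]
    by (simp add: integral_unique algebra_simps)
  have "\<bar>\<integral>y\<in>{a..b}. r y * g y \<partial>lborel\<bar> \<le> (\<integral>y\<in>{a..b}. \<bar>r y * g y\<bar> \<partial>lborel)"
    using set_integral_norm_bound[OF int] by simp
  also have "\<dots> \<le> (\<integral>y\<in>{a..b}. D / 2 * (\<kappa> * (1 / c y)) * ?e y \<partial>lborel)"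
  proof (rule set_integral_mono)
    show "set_integrable lborel {a..b} (\<lambda>y. \<bar>r y * g y\<bar>)"
      using set_integrable_abs[OF int] .
    show "set_integrable lborel {a..b} (\<lambda>y. D / 2 * (\<kappa> * (1 / c y)) * ?e y)"
      by (rule borel_integrable_atLeastAtMost'[OF cont])
    fix y assume y: "y \<in> {a..b}"
    have r_le: "\<bar>r y\<bar> \<le> \<kappa> / 2 / c y"
      using \<kappa>[of y] c_pos[of y] y ab by (simp add: field_simps)
    then have "\<bar>r y * g y\<bar> \<le> (\<kappa> / 2 / c y) * (D * ?e y)"
      unfolding abs_mult
      by (rule mult_mono[OF _ g[OF y] order_trans[OF abs_ge_zero r_le] abs_ge_zero])
    then show "\<bar>r y * g y\<bar> \<le> D / 2 * (\<kappa> * (1 / c y)) * ?e y"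
      by (simp add: mult_ac)
  qed
  finally show ?thesis unfolding val .
qed

text \<open>Compactness bounds the amplitudes for times in \<open>{0..T}\<close>, where the weight
  is at least 1; at nonpositive times they vanish, so the weighted bound survives as the weight
  tends to 0.\<close>

lemma amp_bounded:
  assumes "\<kappa> \<ge> 0"
  obtains C where "C \<ge> 0"
    "\<And>\<epsilon> x s. \<epsilon> = 1 \<or> \<epsilon> = -1 \<Longrightarrow> x \<in> {0..xp} \<Longrightarrow> s \<le> T \<Longrightarrow> \<bar>amp \<epsilon> x s\<bar> \<le> C * exp (\<kappa> * s)"
proof -
  have "\<exists>C>0. \<forall>x\<in>{0..xp}. \<forall>s\<in>{0..T}. \<bar>amp \<epsilon> x s\<bar> \<le> C" for \<epsilon>
  proof -
    have "bounded ((\<lambda>z. amp \<epsilon> (fst z) (snd z)) ` ({0..xp} \<times> {0..T}))"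
      by (intro compact_imp_bounded compact_continuous_image continuous_on_subset[OF amp_cont] compact_Times) auto
    then obtain C where "C > 0" "\<forall>v\<in>(\<lambda>z. amp \<epsilon> (fst z) (snd z)) ` ({0..xp} \<times> {0..T}). norm v \<le> C"
      unfolding bounded_pos by blast
    then show ?thesis by (intro exI[of _ C]) auto
  qed
  then obtain C1 C2 where C: "C1 > 0" "C2 > 0"
    "\<forall>x\<in>{0..xp}. \<forall>s\<in>{0..T}. \<bar>amp 1 x s\<bar> \<le> C1"
    "\<forall>x\<in>{0..xp}. \<forall>s\<in>{0..T}. \<bar>amp (-1) x s\<bar> \<le> C2"
    by blast
  show ?thesis
  proof (rule that[of "C1 + C2"])
    show "C1 + C2 \<ge> 0"
      using C(1,2) by simp
    fix \<epsilon> x s :: real assume \<epsilon>: "\<epsilon> = 1 \<or> \<epsilon> = -1" and x: "x \<in> {0..xp}" and s: "s \<le> T"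
    show "\<bar>amp \<epsilon> x s\<bar> \<le> (C1 + C2) * exp (\<kappa> * s)"
    proof (cases "s \<le> 0")
      case True
      then show ?thesis
        using x C(1,2) by (simp add: amp_nonpos_time)
    next
      case False
      then have "\<bar>amp 1 x s\<bar> \<le> C1" "\<bar>amp (-1) x s\<bar> \<le> C2"
        using C(3,4) x s by auto
      then have "\<bar>amp \<epsilon> x s\<bar> \<le> (C1 + C2) * 1"
        using C(1,2) \<epsilon> by auto
      also have "\<dots> \<le> (C1 + C2) * exp (\<kappa> * s)"
        using False assms C(1,2) by (intro mult_left_mono) auto
      finally show ?thesis .
    qed
  qed
qed

text \<open>The bound covers all times up to \<open>T\<close>, negative ones included: backward
  characteristics never exceed their starting time but may leave through \<open>t = 0\<close>, so
  this range is closed under the recursion.\<close>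

lemma error_decay:
  "\<exists>C \<kappa>. \<forall>n. \<forall>x\<in>{0..xp}. \<forall>s\<le>T. \<bar>right_error n x s\<bar> \<le> C / 2 ^ n * exp (\<kappa> * s) \<and>
    \<bar>left_error n x s\<bar> \<le> C / 2 ^ n * exp (\<kappa> * s)"
proof -
  \<comment> \<open>Any positive bound of \<open>2 * \<bar>r\<bar> * c\<close> on the slab can serve
    as \<open>\<kappa>\<close>; the factor 2 produces the contraction constant
    \<open>1/2\<close>.\<close>
  have "bounded ((\<lambda>y. 2 * (\<bar>r y\<bar> * c y)) ` {0..xp})"
    using xp by (intro compact_imp_bounded compact_continuous_image continuous_intros r_cont
        continuous_on_subset[OF c_cont]) auto
  then obtain \<kappa> where \<kappa>_pos: "\<kappa> > 0"
    and \<kappa>_bound: "\<forall>y\<in>{0..xp}. \<bar>2 * (\<bar>r y\<bar> * c y)\<bar> \<le> \<kappa>"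
    unfolding bounded_pos by auto
  have \<kappa>: "\<bar>r y\<bar> * c y \<le> \<kappa> / 2" if "y \<in> {0..xp}" for y
    using order_trans[OF abs_ge_self bspec[OF \<kappa>_bound that]] by simp
  obtain C where C: "C \<ge> 0"
    "\<And>\<epsilon> x s. \<epsilon> = 1 \<or> \<epsilon> = -1 \<Longrightarrow> x \<in> {0..xp} \<Longrightarrow> s \<le> T \<Longrightarrow> \<bar>amp \<epsilon> x s\<bar> \<le> C * exp (\<kappa> * s)"
    using amp_bounded[of \<kappa> T] \<kappa>_pos by auto
  have left_step: "\<bar>left_error n x s\<bar> \<le> D / 2 * exp (\<kappa> * s)"
    if x: "x \<in> {0..xp}" and s: "s \<le> T" and D: "D \<ge> 0"
      and E: "\<And>x s. x \<in> {0..xp} \<Longrightarrow> s \<le> T \<Longrightarrow> \<bar>right_error n x s\<bar> \<le> D * exp (\<kappa> * s)" for n x s D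
  proof -
    have "\<bar>left_error n x s\<bar> \<le> D / 2 * (-1) * (exp (\<kappa> * (s + \<tau> x + (-1) * \<tau> xp)) - exp (\<kappa> * (s + \<tau> x + (-1) * \<tau> x)))"
      unfolding conjunct2[OF left_error_eq[OF x]]
    proof (rule weighted_scattering_bound[OF _ _ _ _ conjunct1[OF left_error_eq[OF x]] _ \<kappa>])
      fix y assume y: "y \<in> {x..xp}"
      then show "\<bar>right_error n y (s + \<tau> x - \<tau> y)\<bar> \<le> D * exp (\<kappa> * (s + \<tau> x + (-1) * \<tau> y))"
        using E[of y "s + \<tau> x - \<tau> y"] x s monoD[OF tau_mono, of x y] by simp
    qed (use x in auto)
    also have "\<dots> = D / 2 * exp (\<kappa> * s) - D / 2 * exp (\<kappa> * (s + \<tau> x - \<tau> xp))"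
      by (simp add: algebra_simps)
    also have "\<dots> \<le> D / 2 * exp (\<kappa> * s)"
      using D by simp
    finally show ?thesis .
  qed
  have right_step: "\<bar>right_error (Suc n) x s\<bar> \<le> D / 2 * exp (\<kappa> * s)"
    if x: "x \<in> {0..xp}" and s: "s \<le> T" and D: "D \<ge> 0"
      and F: "\<And>x s. x \<in> {0..xp} \<Longrightarrow> s \<le> T \<Longrightarrow> \<bar>left_error n x s\<bar> \<le> D * exp (\<kappa> * s)" for n x s D
  proof -
    have "\<bar>right_error (Suc n) x s\<bar> \<le> D / 2 * 1 * (exp (\<kappa> * (s - \<tau> x + 1 * \<tau> x)) - exp (\<kappa> * (s - \<tau> x + 1 * \<tau> 0)))"
      unfolding conjunct2[OF right_error_Suc_eq[OF x]] abs_minus_cancel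
    proof (rule weighted_scattering_bound[OF _ _ _ _ conjunct1[OF right_error_Suc_eq[OF x]] _ \<kappa>])
      fix y assume y: "y \<in> {0..x}"
      then show "\<bar>left_error n y (s - \<tau> x + \<tau> y)\<bar> \<le> D * exp (\<kappa> * (s - \<tau> x + 1 * \<tau> y))"
        using F[of y "s - \<tau> x + \<tau> y"] x s monoD[OF tau_mono, of y x] by simp
    qed (use x in auto)
    also have "\<dots> = D / 2 * exp (\<kappa> * s) - D / 2 * exp (\<kappa> * (s - \<tau> x))"
      by (simp add: algebra_simps)
    also have "\<dots> \<le> D / 2 * exp (\<kappa> * s)"
      using D by simp
    finally show ?thesis .
  qed
  have decay: "\<forall>x\<in>{0..xp}. \<forall>s\<le>T. \<bar>right_error n x s\<bar> \<le> C / 2 ^ n * exp (\<kappa> * s) \<and>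
      \<bar>left_error n x s\<bar> \<le> C / 2 ^ n * exp (\<kappa> * s)" for n
  proof (induction n)
    case 0
    then show ?case
      using C(2) by (simp add: right_error_def left_error_def)
  next
    case (Suc n)
    have R: "\<bar>right_error (Suc n) x s\<bar> \<le> C / 2 ^ Suc n * exp (\<kappa> * s)" if "x \<in> {0..xp}" "s \<le> T" for x s
      using right_step[OF that, of "C / 2 ^ n" n] Suc C(1) by (simp add: mult.commute)
    have "\<bar>left_error (Suc n) x s\<bar> \<le> C / 2 ^ Suc n * exp (\<kappa> * s)" if "x \<in> {0..xp}" "s \<le> T" for x s
    proof -
      have "\<bar>left_error (Suc n) x s\<bar> \<le> C / 2 ^ Suc n / 2 * exp (\<kappa> * s)"
        using left_step[OF that _ R] C(1) by simp
      \<comment> \<open>One index step consists of two scatterings; the second gain of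
        \<open>1/2\<close> is dropped to keep one common bound for both errors.\<close>
      also have "\<dots> \<le> C / 2 ^ Suc n * exp (\<kappa> * s)"
        using C(1) by (intro mult_right_mono) (auto simp: field_simps)
      finally show ?thesis .
    qed
    then show ?case using R by blast
  qed
  show ?thesis
    by (rule exI[of _ C], rule exI[of _ \<kappa>]) (rule allI, rule decay)
qed

lemma partial_sums_converge:
  assumes x: "x \<in> {0..xp}"
  shows "(\<lambda>m. right_term m x t) sums amp 1 x t" and "(\<lambda>m. left_term m x t) sums amp (-1) x t"
proof -
  obtain C \<kappa> where E: "\<forall>n. \<forall>x\<in>{0..xp}. \<forall>s\<le>t. \<bar>right_error n x s\<bar> \<le> C / 2 ^ n * exp (\<kappa> * s) \<and>
      \<bar>left_error n x s\<bar> \<le> C / 2 ^ n * exp (\<kappa> * s)"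
    using error_decay[of t] by (elim exE)
  have "(\<lambda>n. C * exp (\<kappa> * t) * (1 / 2) ^ n) \<longlonglongrightarrow> C * exp (\<kappa> * t) * 0"
    by (intro tendsto_intros LIMSEQ_realpow_zero) auto
  then have lim: "(\<lambda>n. C / 2 ^ n * exp (\<kappa> * t)) \<longlonglongrightarrow> 0"
    by (simp add: power_divide)
  have "(\<lambda>n. right_error n x t) \<longlonglongrightarrow> 0" "(\<lambda>n. left_error n x t) \<longlonglongrightarrow> 0"
    by (rule Lim_null_comparison[OF _ lim]; use E x in simp)+
  from tendsto_diff[OF tendsto_const[of "amp 1 x t"] this(1)]
    tendsto_diff[OF tendsto_const[of "amp (-1) x t"] this(2)]
  show "(\<lambda>m. right_term m x t) sums amp 1 x t" "(\<lambda>m. left_term m x t) sums amp (-1) x t"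
    by (simp_all add: sums_def right_error_def left_error_def)
qed

lemma w1_sums: "x \<in> {0..xp} \<Longrightarrow> (\<lambda>m. w1 K \<rho> xp p0 m x t) sums (G x * amp (-1) x t)"
  and w2_sums: "x \<in> {0..xp} \<Longrightarrow> (\<lambda>m. w2 K \<rho> xp p0 m x t) sums (G x * amp 1 x t)"
  unfolding w1_eq_left_term w2_eq_right_term
  by (rule sums_mult, rule partial_sums_converge, assumption)+

end

theorem mainTheorem7:
  fixes K \<rho> p0 :: "real \<Rightarrow> real" and xp Km \<rho>m Kp \<rho>p :: real
    and p u :: "real \<Rightarrow> real \<Rightarrow> real"
  assumes xp: "xp > 0"
    and Kpos: "\<And>x. K x > 0" and \<rho>pos: "\<And>x. \<rho> x > 0"
    and Kcont: "continuous_on UNIV K" and \<rho>cont: "continuous_on UNIV \<rho>"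
    and Kleft: "\<And>x. x < 0 \<Longrightarrow> K x = Km" and \<rho>left: "\<And>x. x < 0 \<Longrightarrow> \<rho> x = \<rho>m"
    and Kright: "\<And>x. x > xp \<Longrightarrow> K x = Kp" and \<rho>right: "\<And>x. x > xp \<Longrightarrow> \<rho> x = \<rho>p"
    and KC1: "\<exists>K'. (\<forall>x\<in>{0..xp}. (K has_real_derivative K' x) (at x within {0..xp}))
                  \<and> continuous_on {0..xp} K'"
    and \<rho>C1: "\<exists>\<rho>'. (\<forall>x\<in>{0..xp}. (\<rho> has_real_derivative \<rho>' x) (at x within {0..xp}))
                  \<and> continuous_on {0..xp} \<rho>'"
    and p0C1: "\<exists>p0'. (\<forall>\<xi>. (p0 has_real_derivative p0' \<xi>) (at \<xi>))
                  \<and> continuous_on UNIV p0' \<and> bounded (range p0')"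
    and p0bdd: "bounded (range p0)"
    and p0zero: "\<And>\<xi>. \<xi> \<ge> 0 \<Longrightarrow> p0 \<xi> = 0"
    and sol: "classical_solution K \<rho> p0 p u"
  shows "(\<forall>t\<ge>0. \<forall>x\<in>{0..xp}.
            summable (\<lambda>m. w1 K \<rho> xp p0 m x t) \<and>
            summable (\<lambda>m. w2 K \<rho> xp p0 m x t) \<and>
            p x t = (\<Sum>m. w1 K \<rho> xp p0 m x t) + (\<Sum>m. w2 K \<rho> xp p0 m x t))
       \<and> (\<forall>t\<ge>0. (\<lambda>m. Rf K \<rho> xp p0 m t) sums (p 0 t - p0 (- cm K \<rho> * t))
               \<and> (\<lambda>m. Tf K \<rho> xp p0 m t) sums (p xp t))"
proof -
  obtain p0' where "\<And>\<xi>. (p0 has_real_derivative p0' \<xi>) (at \<xi>)"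
    using p0C1 by blast
  then have p0_cont: "continuous_on UNIV p0"
    by (rule DERIV_continuous_on)
  interpret scattering K \<rho> xp Km \<rho>m Kp \<rho>p p0 p u
    by unfold_locales (fact assms p0_cont)+
  show ?thesis
  proof (intro conjI allI impI ballI)
    fix t x :: real assume t: "t \<ge> 0" and x: "x \<in> {0..xp}"
    note w = w1_sums[OF x, of t] w2_sums[OF x, of t]
    show "summable (\<lambda>m. w1 K \<rho> xp p0 m x t)" "summable (\<lambda>m. w2 K \<rho> xp p0 m x t)"
      using w by (auto dest: sums_summable)
    show "p x t = (\<Sum>m. w1 K \<rho> xp p0 m x t) + (\<Sum>m. w2 K \<rho> xp p0 m x t)"
      using sums_unique[OF w(1)] sums_unique[OF w(2)] p_eq_amp[OF t, of x] by (simp add: distrib_left)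
  next
    fix t :: real assume t: "t \<ge> 0"
    \<comment> \<open>At the left interface \<open>G\<close> is 1 and the right-going amplitude is
      the incident wave; subtracting it leaves the reflected wave.\<close>
    have "p 0 t - p0 (- cm K \<rho> * t) = G 0 * amp (-1) 0 t"
      using p_eq_amp[OF t, of 0] amp_left_boundary[of t] by simp
    then show "(\<lambda>m. Rf K \<rho> xp p0 m t) sums (p 0 t - p0 (- cm K \<rho> * t))"
      using w1_sums[of 0 t] xp unfolding Rf_def by auto
    have "p xp t = G xp * amp 1 xp t"
      using p_eq_amp[OF t, of xp] amp_right_boundary[of t] by simp
    then show "(\<lambda>m. Tf K \<rho> xp p0 m t) sums (p xp t)"
      using w2_sums[of xp t] xp unfolding Tf_def by auto
  qed
qed

end
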